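(* Let $d\in\mathbb{N}$ and $r\in\mathbb{N}$, $r\ge 2$. Let $m\in\mathbb{N}$, $\mathbf a\in\mathbb{Z}^d$, and suppose that the Korobov cubature formula $P_m(\cdot,\mathbf a)$ is exact on $\mathcal T(L,d)$ for some $L\in\mathbb{N}$, $L\ge 2$. There exist constants $c(d),C(d)>0$ (depending only on $d$) such that for any $v\in(0,1]$ with $v\ge c(d)/L$ we have $$\tilde D^{r}_\infty(\mathcal K_m(\mathbf a),v)\le C(d)\,L^{-r}\,(\log (Lv))^{d-1}.$$
   Context: Let $\Omega_d=[0,1)^d$. Hat functions: for $u>0$ let $h^1_u$ be the characteristic function on $\mathbb{R}$ of the interval $[-u/2,u/2)$, and for $r\ge 2$ let $h^r_u:=h^{r-1}_u * h^1_u$ (convolution on $\mathbb{R}$). For a box $B=\prod_{j=1}^d[z_j-ru_j/2,\,z_j+ru_j/2)$ with $u_j>0$ (every axis-parallel half-open box is of this form) define $h^r_B(\mathbf x):=\prod_{j=1}^d h^r_{u_j}(x_j-z_j)$. Its periodization is $\tilde h^r_B(\mathbf x):=\sum_{\mathbf n\in\mathbb{Z}^d}h^r_B(\mathbf n+\mathbf x)$. Periodic $r$-smooth fixed volume $L_\infty$-discrepancy: for $r\in\mathbb{N}$, $v\in(0,1]$ and a point set $\xi=\{\xi^\mu\}_{\mu=1}^m\subset[0,1)^d$ (points indexed by $\mu$, counted with multiplicity), $$\tilde D^r_\infty(\xi,v):=\sup_{B\subset\Omega_d:\ \mathrm{vol}(B)=v}\left\|\int_{\Omega_d}\tilde h^r_B(\mathbf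 x-\mathbf z)\,d\mathbf x-\frac1m\sum_{\mu=1}^m\tilde h^r_B(\xi^\mu-\mathbf z)\right\|_\infty,$$ where the supremum is over boxes $B=\prod_{j=1}^d[w_j-ru_j/2,\,w_j+ru_j/2)$ with $w_j\in\mathbb{R}$ and $u_j>0$, and the $L_\infty$-norm is taken with respect to $\mathbf z\in\Omega_d$. Korobov point sets and cubature formulas: for $m\in\mathbb{N}$ and $\mathbf a=(a_1,\dots,a_d)\in\mathbb{Z}^d$ put $\mathbf y^\mu:=(\{\mu a_1/m\},\dots,\{\mu a_d/m\})$, $\mu=1,\dots,m$, where $\{\cdot\}$ is the fractional part; $\mathcal K_m(\mathbf a):=\{\mathbf y^\mu\}_{\mu=1}^m$ and $P_m(f,\mathbf a):=\frac1m\sum_{\mu=1}^m f(\mathbf y^\mu)$. Hyperbolic cross: $\Gamma(N,d):=\{\mathbf k\in\mathbb{Z}^d:\prod_{j=1}^d\max(|k_j|,1)\le N\}$, and $\mathcal T(N,d)$ is the space of trigonometric polynomials $f(\mathbf x)=\sum_{\mathbf k\in\Gamma(N,d)}c_{\mathbf k}e^{i2\pi(\mathbf k,\mathbf x)}$. Exactness: $P_m(\cdot,\mathbf a)$ is exact on $\mathcal T(N,d)$ if $P_m(f,\mathbf a)=\int_{[0,1)^d}f(\mathbf x)\,d\mathbf x$ for all $f\in\mathcal T(N,d)$; equivalently, no $\mathbf k\in\Gamma(N,d)\setminus\{\mathbf 0\}$ satisfies $a_1k_1+\dots+a_dk_d\equiv 0\pmod m$. The constants do not depend on $m$, $\mathbf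 a$, $L$ or $v$. *)

theory Defs
  imports "HOL-Probability.Essential_Supremum"
begin

text \<open>The dimension is the cardinality of the (finite) index type \<open>'n\<close>:
  points are in \<open>real ^ 'n\<close>, frequencies and lattice shifts in \<open>int ^ 'n\<close>.\<close>

definition unit_cube :: "(real ^ 'n) set"
  where "unit_cube = {x. \<forall>j. 0 \<le> x $ j \<and> x $ j < 1}"

definition int_vec :: "int ^ 'n \<Rightarrow> real ^ 'n"
  where "int_vec n = (\<chi> j. of_int (n $ j))"


subsection \<open>Hat functions and their periodization\<close>

definition real_convolution :: "(real \<Rightarrow> real) \<Rightarrow> (real \<Rightarrow> real) \<Rightarrow> real \<Rightarrow> real"
  where "real_convolution f g x = (LINT y|lborel. f y * g (x - y))"

text \<open>Only orders at least 1 are meaningful; the value for order 0 is a dummy.\<close>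

fun hat :: "nat \<Rightarrow> real \<Rightarrow> real \<Rightarrow> real" where
  "hat 0 u = (\<lambda>x. 0)"
| "hat (Suc 0) u = indicator {- u / 2 ..< u / 2}"
| "hat (Suc (Suc r)) u = real_convolution (hat (Suc r) u) (hat (Suc 0) u)"

text \<open>A box is given by its centre \<open>w\<close> and the vector \<open>u\<close> of its side lengths divided by \<open>r\<close>.
  For fixed \<open>r > 0\<close> and positive \<open>u\<close> this parametrization of half-open boxes is one-to-one.\<close>

definition hat_box :: "nat \<Rightarrow> real ^ 'n \<Rightarrow> real ^ 'n \<Rightarrow> (real ^ 'n) set"
  where "hat_box r w u =
    {x. \<forall>j. w $ j - real r * u $ j / 2 \<le> x $ j \<and> x $ j < w $ j + real r * u $ j / 2}"

definition box_hat :: "nat \<Rightarrow> real ^ 'n \<Rightarrow> real ^ 'n \<Rightarrow> real ^ 'n \<Rightarrow> real"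
  where "box_hat r w u x = (\<Prod>j\<in>UNIV. hat r (u $ j) (x $ j - w $ j))"

definition periodic_box_hat :: "nat \<Rightarrow> real ^ 'n \<Rightarrow> real ^ 'n \<Rightarrow> real ^ 'n \<Rightarrow> real"
  where "periodic_box_hat r w u x = (\<Sum>\<^sub>\<infinity>n\<in>UNIV. box_hat r w u (int_vec n + x))"


subsection \<open>Periodic smooth discrepancy with fixed volume\<close>

definition admissible_boxes :: "nat \<Rightarrow> real \<Rightarrow> ((real ^ 'n) \<times> (real ^ 'n)) set"
  where "admissible_boxes r v =
    {(w, u). (\<forall>j. u $ j > 0) \<and> hat_box r w u \<subseteq> unit_cube \<and>
             measure lborel (hat_box r w u) = v}"

text \<open>The value is an extended real, so neither the supremum over the boxes nor the
  essential supremum over the shifts \<open>z\<close> needs a boundedness side condition. The point set is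
  the family \<open>\<xi> 1, \<dots>, \<xi> m\<close>.\<close>

definition periodic_discrepancy :: "nat \<Rightarrow> nat \<Rightarrow> (nat \<Rightarrow> real ^ 'n) \<Rightarrow> real \<Rightarrow> ereal"
  where "periodic_discrepancy r m \<xi> v =
    (SUP (w, u) \<in> admissible_boxes r v.
       esssup (restrict_space lborel unit_cube)
         (\<lambda>z. ereal \<bar>(LINT x:unit_cube|lborel. periodic_box_hat r w u (x - z))
                   - 1 / real m * (\<Sum>\<mu>=1..m. periodic_box_hat r w u (\<xi> \<mu> - z))\<bar>))"


subsection \<open>Korobov cubature formulas\<close>

definition korobov_point :: "nat \<Rightarrow> int ^ 'n \<Rightarrow> nat \<Rightarrow> real ^ 'n"
  where "korobov_point m a \<mu> = (\<chi> j. frac (real \<mu> * of_int (a $ j) / real m))"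

definition korobov_cubature :: "nat \<Rightarrow> int ^ 'n \<Rightarrow> (real ^ 'n \<Rightarrow> complex) \<Rightarrow> complex"
  where "korobov_cubature m a f = 1 / of_nat m * (\<Sum>\<mu>=1..m. f (korobov_point m a \<mu>))"

definition hyperbolic_cross :: "nat \<Rightarrow> (int ^ 'n) set"
  where "hyperbolic_cross N = {k. (\<Prod>j\<in>UNIV. max \<bar>k $ j\<bar> 1) \<le> int N}"

text \<open>Finiteness matters because \<open>sum\<close> over an infinite set is 0.\<close>

lemma finite_hyperbolic_cross: "finite (hyperbolic_cross N :: (int ^ 'n) set)"
proof -
  have "\<bar>k $ i\<bar> \<le> int N" if "k \<in> hyperbolic_cross N" for k :: "int ^ 'n" and i
  proof -
    have "max \<bar>k $ i\<bar> 1 \<le> max \<bar>k $ i\<bar> 1 * (\<Prod>j\<in>UNIV - {i}. max \<bar>k $ j\<bar> 1)"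
      using prod_mono[of "UNIV - {i}" "\<lambda>_. 1" "\<lambda>j. max \<bar>k $ j\<bar> 1"]
      by (intro mult_le_cancel_left1[THEN iffD2]) auto
    also have "\<dots> = (\<Prod>j\<in>UNIV. max \<bar>k $ j\<bar> 1)"
      by (simp add: prod.remove[of UNIV i])
    finally show ?thesis
      using that by (simp add: hyperbolic_cross_def)
  qed
  then have "hyperbolic_cross N \<subseteq>
      vec_lambda ` (PiE UNIV (\<lambda>_. {- int N .. int N}) :: ('n \<Rightarrow> int) set)"
    by (intro subsetI image_eqI[of _ vec_lambda "vec_nth _"]) (auto simp: abs_le_iff minus_le_iff)
  then show ?thesis
    by (rule finite_subset) (intro finite_imageI finite_PiE; simp)
qed

definition trig_polys :: "nat \<Rightarrow> (real ^ 'n \<Rightarrow> complex) set"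
  where "trig_polys N = {f. \<exists>c. f = (\<lambda>x. \<Sum>k\<in>hyperbolic_cross N.
           c k * exp (\<i> * of_real (2 * pi * (int_vec k \<bullet> x))))}"

definition korobov_exact :: "nat \<Rightarrow> int ^ 'n \<Rightarrow> nat \<Rightarrow> bool"
  where "korobov_exact m a N \<longleftrightarrow>
    (\<forall>f\<in>trig_polys N. korobov_cubature m a f = (LINT x:unit_cube|lborel. f x))"

end

theory Submission
  imports Defs
begin

text \<open>For \<open>r \<ge> 2\<close> the periodized hat function of order \<open>r\<close> and width \<open>u\<close> is the sum of its Fourier
  series, with coefficients \<open>(sin (\<pi> k u) / (\<pi> k)) ^ r\<close>. Hence the error of the Korobov formula is a
  sum of products of such coefficients over the nonzero points \<open>k\<close> of the dual lattice
  \<open>{k. m dvd a \<bullet> k}\<close>, which by exactness has no nonzero point in the hyperbolic cross of order \<open>L\<close>.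
  A dyadic block \<open>\<bar>k\<^sub>j\<bar> \<approx> 2 ^ s\<^sub>j\<close> is therefore empty unless \<open>2 ^ \<Sum>s\<^sub>j > L\<close>, and contains
  \<open>O(2 ^ \<Sum>s\<^sub>j / L)\<close> points. Every coefficient is at most \<open>min u\<^sub>j (2 ^ (- s\<^sub>j))\<close> to the power
  \<open>r\<close>, and the product of these minima is at most \<open>1 / L\<close>; so \<open>r - 2\<close> powers of \<open>L\<close> split off with
  constant \<open>1\<close> and the case \<open>r = 2\<close> remains. There the block sums decay geometrically in
  \<open>\<Sum>\<bar>s\<^sub>j - log\<^sub>2 (1 / u\<^sub>j)\<bar>\<close>, which gives \<open>(log (L v)) ^ (d - 1)\<close> instead of \<open>(log L) ^ (d - 1)\<close>.\<close>

subsection \<open>The Fourier series of the second Bernoulli polynomial\<close>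

text \<open>This is the imaginary part of the logarithm series at \<open>\<rho> * cis t\<close>. Its
  terms are the derivatives in \<open>t\<close> of the terms of the cosine series in the next
  lemma.\<close>

lemma sums_cos_powser_deriv:
  fixes \<rho> t :: real
  assumes "0 \<le> \<rho>" "\<rho> < 1"
  shows "(\<lambda>n. - (\<rho> ^ Suc n * sin (real (Suc n) * t) / real (Suc n))) sums Im (Ln (1 - \<rho> * cis t))"
proof -
  have "cmod (- (\<rho> * cis t)) < 1" using assms by (simp add: norm_mult)
  from Ln_series'[OF this]
  have "(\<lambda>n. - ((\<rho> * cis t) ^ n) / of_nat n) sums Ln (1 - \<rho> * cis t)" by simp
  \<comment> \<open>The term with index 0 is a division by \<open>of_nat 0\<close>, hence 0, so the
    index can be shifted without changing the sum.\<close>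
  then have "(\<lambda>n. - ((\<rho> * cis t) ^ Suc n) / of_nat (Suc n)) sums Ln (1 - \<rho> * cis t)"
    by (subst sums_Suc_iff) simp
  from sums_Im[OF this] show ?thesis
    by (simp only: power_mult_distrib DeMoivre of_real_power[symmetric])
       (simp add: Im_divide_of_nat Complex.DeMoivre del: of_nat_Suc of_real_power power_Suc)
qed

text \<open>For radius below 1 the differentiated series has a geometric majorant, so termwise
  differentiation is allowed. At radius 1 the sine series no longer converges uniformly, which is
  why the result is reached by Abel summation.\<close>

lemma has_field_derivative_cos_powser:
  fixes \<rho> t :: real
  assumes "0 \<le> \<rho>" "\<rho> < 1"
  shows "((\<lambda>t. \<Sum>n. \<rho> ^ Suc n * cos (real (Suc n) * t) / real (Suc n) ^ 2)
           has_field_derivative Im (Ln (1 - \<rho> * cis t))) (at t)"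
proof -
  have "((\<lambda>t. \<Sum>n. \<rho> ^ Suc n * cos (real (Suc n) * t) / real (Suc n) ^ 2)
           has_field_derivative (\<Sum>n. - (\<rho> ^ Suc n * sin (real (Suc n) * t) / real (Suc n)))) (at t)"
  proof (rule has_field_derivative_series'(2)[where S = UNIV and ?x0.0 = 0])
    show "uniformly_convergent_on UNIV
      (\<lambda>n x. \<Sum>i<n. - (\<rho> ^ Suc i * sin (real (Suc i) * x) / real (Suc i)))"
    proof (rule Weierstrass_m_test')
      show "summable (\<lambda>n. \<rho> ^ Suc n)" using assms by (subst summable_Suc_iff) simp
      show "norm (- (\<rho> ^ Suc n * sin (real (Suc n) * x) / real (Suc n))) \<le> \<rho> ^ Suc n" for n x
      proof -
        have "\<bar>\<rho> ^ Suc n * sin (real (Suc n) * x)\<bar> \<le> \<rho> ^ Suc n * 1"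
          unfolding abs_mult using assms by (intro mult_mono) auto
        also have "\<dots> \<le> \<rho> ^ Suc n * real (Suc n)"
          using assms by (intro mult_left_mono) auto
        finally show ?thesis
          by (simp add: divide_le_eq del: of_nat_Suc power_Suc)
      qed
    qed
    show "summable (\<lambda>n. \<rho> ^ Suc n * cos (real (Suc n) * 0) / (real (Suc n))\<^sup>2)"
    proof (rule summable_comparison_test'[where N = 0])
      show "summable (\<lambda>n. \<rho> ^ Suc n)" using assms by (subst summable_Suc_iff) simp
      show "norm (\<rho> ^ Suc n * cos (real (Suc n) * 0) / (real (Suc n))\<^sup>2) \<le> \<rho> ^ Suc n" for n
      proof -
        have "1 \<le> (real (Suc n))\<^sup>2" by simp
        then have "\<rho> ^ Suc n * 1 \<le> \<rho> ^ Suc n * (real (Suc n))\<^sup>2"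
          using assms by (intro mult_left_mono) auto
        then show ?thesis using assms by (simp add: divide_le_eq abs_mult del: of_nat_Suc power_Suc)
      qed
    qed
    fix n :: nat and x :: real
    show "((\<lambda>t. \<rho> ^ Suc n * cos (real (Suc n) * t) / (real (Suc n))\<^sup>2) has_field_derivative
           - (\<rho> ^ Suc n * sin (real (Suc n) * x) / real (Suc n))) (at x within UNIV)"
      by (auto intro!: derivative_eq_intros simp: power2_eq_square field_simps simp del: of_nat_Suc power_Suc)
  qed auto
  then show ?thesis
    using sums_unique[OF sums_cos_powser_deriv[OF assms, of t]] by simp
qed

text \<open>Factor \<open>1 - cis t\<close> as \<open>2 * sin (t / 2)\<close> times
  \<open>cis ((t - pi) / 2)\<close>. The first factor is positive and the angle lies in the
  principal range, so the logarithm can be read off.\<close>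

lemma Im_Ln_one_minus_cis:
  assumes "0 < t" "t < 2 * pi"
  shows "Im (Ln (1 - cis t)) = (t - pi) / 2"
proof -
  have pos: "0 < sin (t / 2)" using assms by (intro sin_gt_zero) auto
  define z where "z = Complex (ln (2 * sin (t / 2))) ((t - pi) / 2)"
  have "exp z = of_real (2 * sin (t / 2)) * cis ((t - pi) / 2)"
    using pos by (simp add: z_def exp_eq_polar)
  also have "\<dots> = 1 - cis t"
  proof (rule complex_eqI)
    have e: "(t - pi) / 2 = t / 2 - pi / 2" by simp
    have c: "cos t = 1 - 2 * sin (t/2) ^ 2" "sin t = 2 * sin (t/2) * cos (t/2)"
      using cos_double_sin[of "t/2"] sin_double[of "t/2"] by simp_all
    show "Re (of_real (2 * sin (t / 2)) * cis ((t - pi) / 2)) = Re (1 - cis t)"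
      unfolding e by (simp add: cos_diff c power2_eq_square)
    show "Im (of_real (2 * sin (t / 2)) * cis ((t - pi) / 2)) = Im (1 - cis t)"
      unfolding e by (simp add: sin_diff c)
  qed
  finally have "Ln (1 - cis t) = z"
    by (rule Ln_unique) (use assms in \<open>simp_all add: z_def\<close>)
  then show ?thesis by (simp add: z_def)
qed

text \<open>Dominated convergence for series: the terms are bounded by
  \<open>1 / real (Suc k) ^ 2\<close> for every radius in [0, 1].\<close>

lemma cos_powser_Abel:
  assumes "\<And>n. 0 \<le> \<rho> n \<and> \<rho> n \<le> 1" "\<rho> \<longlonglongrightarrow> 1"
  shows "(\<lambda>m. \<Sum>n. \<rho> m ^ Suc n * cos (real (Suc n) * t) / real (Suc n) ^ 2)
     \<longlonglongrightarrow> (\<Sum>n. cos (real (Suc n) * t) / real (Suc n) ^ 2)"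
proof (rule conjunct2[OF conjunct2[OF tannerys_theorem]])
  show "(\<lambda>m. \<rho> m ^ Suc k * cos (real (Suc k) * t) / real (Suc k) ^ 2)
    \<longlonglongrightarrow> cos (real (Suc k) * t) / real (Suc k) ^ 2" for k
    by (auto intro!: tendsto_eq_intros assms(2) simp del: power_Suc of_nat_Suc)
  show "summable (\<lambda>n. 1 / real (Suc n) ^ 2)"
    using inverse_squares_sums by (simp add: sums_iff)
  show "\<forall>\<^sub>F (k, m) in sequentially \<times>\<^sub>F sequentially.
     norm (\<rho> m ^ Suc k * cos (real (Suc k) * t) / (real (Suc k))\<^sup>2) \<le> 1 / (real (Suc k))\<^sup>2"
  proof (intro always_eventually allI, clarify)
    fix k m
    have "\<bar>\<rho> m ^ Suc k * cos (real (Suc k) * t)\<bar> \<le> 1 * 1"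
      unfolding abs_mult using assms(1)[of m] by (intro mult_mono) (auto intro!: power_le_one simp del: power_Suc)
    then show "norm (\<rho> m ^ Suc k * cos (real (Suc k) * t) / (real (Suc k))\<^sup>2) \<le> 1 / (real (Suc k))\<^sup>2"
      by (simp add: abs_mult divide_right_mono del: power_Suc of_nat_Suc)
  qed
qed auto

lemma summable_cos_squares: "summable (\<lambda>n. cos (real (Suc n) * t) / real (Suc n) ^ 2)"
proof (rule summable_comparison_test'[where N = 0])
  show "summable (\<lambda>n. 1 / real (Suc n) ^ 2)"
    using inverse_squares_sums by (simp add: sums_iff)
  show "norm (cos (real (Suc n) * t) / real (Suc n) ^ 2) \<le> 1 / real (Suc n) ^ 2" for n
    by (simp add: divide_right_mono del: of_nat_Suc)
qed

text \<open>Integrate the derivative over \<open>{t..pi}\<close> for a radius below 1 and let the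
  radius tend to 1. Since \<open>0 < t\<close>, the interval avoids the singularity of
  \<open>Ln (1 - cis x)\<close> at 0, and \<open>pi\<close> dominates every imaginary part of
  \<open>Ln\<close>.\<close>

lemma cos_series_diff:
  assumes "0 < t" "t \<le> pi"
  shows "(\<Sum>n. cos (real (Suc n) * pi) / real (Suc n) ^ 2)
           - (\<Sum>n. cos (real (Suc n) * t) / real (Suc n) ^ 2) = - ((pi - t)\<^sup>2 / 4)"
proof -
  define \<rho> where "\<rho> = (\<lambda>n. 1 + - inverse (real (Suc n)))"
  have \<rho>: "0 \<le> \<rho> n" "\<rho> n < 1" for n by (auto simp: \<rho>_def field_simps)
  have lim\<rho>: "\<rho> \<longlonglongrightarrow> 1"
    unfolding \<rho>_def by (rule LIMSEQ_inverse_real_of_nat_add_minus)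
  define g where "g = (\<lambda>m t. \<Sum>n. \<rho> m ^ Suc n * cos (real (Suc n) * t) / real (Suc n) ^ 2)"
  have g_lim: "(\<lambda>m. g m t) \<longlonglongrightarrow> (\<Sum>n. cos (real (Suc n) * t) / real (Suc n) ^ 2)" for t
    unfolding g_def by (rule cos_powser_Abel) (use \<rho> lim\<rho> in \<open>auto simp: less_imp_le\<close>)
  \<comment> \<open>These points have positive real part, so they stay off the branch cut, where
    \<open>Ln\<close> would be discontinuous.\<close>
  have nonneg: "1 - complex_of_real (\<rho> m) * cis x \<notin> \<real>\<^sub>\<le>\<^sub>0" for m x
  proof -
    have "\<rho> m * cos x \<le> \<rho> m * 1" using \<rho> by (intro mult_left_mono) auto
    also have "\<dots> < 1" using \<rho> by simp
    finally show ?thesis by (auto simp: complex_nonpos_Reals_iff)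
  qed
  have int: "integral\<^sup>L lborel (\<lambda>x. indicator {t..pi} x *\<^sub>R Im (Ln (1 - \<rho> m * cis x)))
      = g m pi - g m t" for m
  proof (rule integral_FTC_atLeastAtMost[OF assms(2), where F = "g m"])
    show "(g m has_vector_derivative Im (Ln (1 - complex_of_real (\<rho> m) * cis x))) (at x within {t..pi})" for x
    proof -
      have "(g m has_real_derivative Im (Ln (1 - complex_of_real (\<rho> m) * cis x))) (at x)"
        unfolding g_def by (rule has_field_derivative_cos_powser[OF \<rho>(1)[of m] \<rho>(2)[of m]])
      then show ?thesis
        unfolding has_real_derivative_iff_has_vector_derivative
        by (rule has_vector_derivative_at_within)
    qed
    show "continuous_on {t..pi} (\<lambda>x. Im (Ln (1 - complex_of_real (\<rho> m) * cis x)))"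
      using nonneg by (intro continuous_intros) auto
  qed
  have "(\<lambda>m. integral\<^sup>L lborel (\<lambda>x. indicator {t..pi} x *\<^sub>R Im (Ln (1 - \<rho> m * cis x))))
     \<longlonglongrightarrow> integral\<^sup>L lborel (\<lambda>x. indicator {t..pi} x *\<^sub>R ((x - pi) / 2))"
  proof (rule integral_dominated_convergence[where w = "\<lambda>x. indicator {t..pi} x *\<^sub>R pi"])
    show "integrable lborel (\<lambda>x. indicator {t..pi} x *\<^sub>R pi)"
      by (intro borel_integrable_compact continuous_intros) auto
    show "(\<lambda>x. indicator {t..pi} x *\<^sub>R ((x - pi) / 2)) \<in> borel_measurable lborel"
      by measurable
    show "(\<lambda>x. indicator {t..pi} x *\<^sub>R Im (Ln (1 - complex_of_real (\<rho> m) * cis x))) \<in> borel_measurable lborel" for m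
    proof -
      have "(\<lambda>x. Im (Ln (1 - complex_of_real (\<rho> m) * cis x))) \<in> borel_measurable borel"
        using nonneg by (intro borel_measurable_continuous_onI continuous_intros) auto
      then show ?thesis by measurable
    qed
    show "AE x in lborel. (\<lambda>m. indicator {t..pi} x *\<^sub>R Im (Ln (1 - complex_of_real (\<rho> m) * cis x)))
            \<longlonglongrightarrow> indicator {t..pi} x *\<^sub>R ((x - pi) / 2)"
    proof (rule AE_I2)
      fix x
      show "(\<lambda>m. indicator {t..pi} x *\<^sub>R Im (Ln (1 - complex_of_real (\<rho> m) * cis x)))
            \<longlonglongrightarrow> indicator {t..pi} x *\<^sub>R ((x - pi) / 2)"
      proof (cases "x \<in> {t..pi}")
        case True
        then have x: "0 < x" "x < 2 * pi" "x \<le> pi" using assms pi_gt_zero by auto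
        have "cos x < 1" using cos_monotone_0_pi[of 0 x] x by simp
        then have "1 - cis x \<notin> \<real>\<^sub>\<le>\<^sub>0" by (auto simp: complex_nonpos_Reals_iff)
        then have "(\<lambda>m. Im (Ln (1 - complex_of_real (\<rho> m) * cis x))) \<longlonglongrightarrow> Im (Ln (1 - complex_of_real 1 * cis x))"
          by (intro tendsto_intros lim\<rho>) auto
        then show ?thesis using x True by (simp add: Im_Ln_one_minus_cis)
      qed simp
    qed
    show "AE x in lborel. norm (indicator {t..pi} x *\<^sub>R Im (Ln (1 - complex_of_real (\<rho> m) * cis x)))
            \<le> indicator {t..pi} x *\<^sub>R pi" for m
    proof (rule AE_I2)
      fix x
      have "1 - complex_of_real (\<rho> m) * cis x \<noteq> 0" using nonneg[of m x] by auto
      then have "\<bar>Im (Ln (1 - complex_of_real (\<rho> m) * cis x))\<bar> \<le> pi"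
        using mpi_less_Im_Ln Im_Ln_le_pi by (smt (verit))
      then show "norm (indicator {t..pi} x *\<^sub>R Im (Ln (1 - complex_of_real (\<rho> m) * cis x)))
            \<le> indicator {t..pi} x *\<^sub>R pi"
        by (auto simp: indicator_def)
    qed
  qed
  moreover have "integral\<^sup>L lborel (\<lambda>x. indicator {t..pi} x *\<^sub>R ((x - pi) / 2))
     = (pi - pi)\<^sup>2 / 4 - (t - pi)\<^sup>2 / 4"
  proof (rule integral_FTC_atLeastAtMost[OF assms(2), where F = "\<lambda>x. (x - pi)\<^sup>2 / 4"])
    show "((\<lambda>x. (x - pi)\<^sup>2 / 4) has_vector_derivative ((x - pi) / 2)) (at x within {t..pi})" for x
      unfolding has_real_derivative_iff_has_vector_derivative[symmetric]
      by (auto intro!: derivative_eq_intros)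
  qed (auto intro!: continuous_intros)
  ultimately have "(\<lambda>m. g m pi - g m t) \<longlonglongrightarrow> (pi - pi)\<^sup>2 / 4 - (t - pi)\<^sup>2 / 4"
    by (simp only: int)
  then have "(\<lambda>m. g m pi - g m t) \<longlonglongrightarrow> - ((pi - t)\<^sup>2 / 4)"
    by (simp add: power2_commute)
  moreover have "(\<lambda>m. g m pi - g m t) \<longlonglongrightarrow> (\<Sum>n. cos (real (Suc n) * pi) / real (Suc n) ^ 2)
           - (\<Sum>n. cos (real (Suc n) * t) / real (Suc n) ^ 2)"
    by (intro tendsto_diff g_lim)
  ultimately show ?thesis using LIMSEQ_unique by blast
qed

lemma continuous_cos_squares:
  "continuous_on UNIV (\<lambda>t. \<Sum>n. cos (real (Suc n) * t) / real (Suc n) ^ 2)"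
proof (rule uniform_limit_theorem)
  show "uniform_limit UNIV (\<lambda>m t. \<Sum>n<m. cos (real (Suc n) * t) / real (Suc n) ^ 2)
     (\<lambda>t. \<Sum>n. cos (real (Suc n) * t) / real (Suc n) ^ 2) sequentially"
  proof (rule Weierstrass_m_test)
    show "summable (\<lambda>n. 1 / real (Suc n) ^ 2)"
      using inverse_squares_sums by (simp add: sums_iff)
    show "norm (cos (real (Suc n) * t) / real (Suc n) ^ 2) \<le> 1 / real (Suc n) ^ 2" for n t
      by (simp add: divide_right_mono del: of_nat_Suc)
  qed
qed (auto intro!: always_eventually continuous_intros)

text \<open>On (0, pi] the sum is known up to the constant \<open>G pi\<close>. Letting
  \<open>t\<close> tend to 0 and using the Basel value pi^2/6 there determines this constant; the
  reflection of \<open>t\<close> to \<open>2 * pi - t\<close> covers the rest of the period.\<close>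

lemma cos_squares_sums:
  assumes "0 \<le> t" "t \<le> 2 * pi"
  shows "(\<lambda>n. cos (real (Suc n) * t) / real (Suc n) ^ 2) sums ((pi - t)\<^sup>2 / 4 - pi\<^sup>2 / 12)"
proof -
  define G where "G = (\<lambda>t. \<Sum>n. cos (real (Suc n) * t) / real (Suc n) ^ 2)"
  have d: "G t = G pi + (pi - t)\<^sup>2 / 4" if "0 < t" "t \<le> pi" for t
    using cos_series_diff[OF that] by (simp add: G_def)
  have "G \<midarrow>0\<rightarrow> G 0"
    using continuous_cos_squares unfolding G_def continuous_on_def by blast
  then have "(G \<longlongrightarrow> G 0) (at_right 0)"
    by (rule filterlim_mono) (auto simp: at_le)
  moreover have "eventually (\<lambda>t. G t = G pi + (pi - t)\<^sup>2 / 4) (at_right 0)"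
    unfolding eventually_at_right_field by (intro exI[of _ pi] conjI allI impI d pi_gt_zero) auto
  ultimately have l1: "((\<lambda>t. G pi + (pi - t)\<^sup>2 / 4) \<longlongrightarrow> G 0) (at_right 0)"
    by (rule Lim_transform_eventually)
  have l2: "((\<lambda>t. G pi + (pi - t)\<^sup>2 / 4) \<longlongrightarrow> G pi + (pi - 0)\<^sup>2 / 4) (at_right 0)"
    by (intro tendsto_intros) simp
  have "G 0 = G pi + pi\<^sup>2 / 4"
    using tendsto_unique[OF trivial_limit_at_right_real l1 l2] by simp
  moreover have "G 0 = pi\<^sup>2 / 6"
    using inverse_squares_sums by (simp add: G_def sums_iff)
  ultimately have Gpi: "G pi = - (pi\<^sup>2 / 12)" by simp
  have G: "G t = (pi - t)\<^sup>2 / 4 - pi\<^sup>2 / 12" if "0 \<le> t" "t \<le> pi" for t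
    using d[of t] that Gpi \<open>G 0 = pi\<^sup>2 / 6\<close> by (cases "t = 0") auto
  have "G t = (pi - t)\<^sup>2 / 4 - pi\<^sup>2 / 12"
  proof (cases "t \<le> pi")
    case False
    have "cos (real (Suc n) * t) = cos (real (Suc n) * (2 * pi - t))" for n
      using cos_diff[of "real (Suc n) * (2 * pi)" "real (Suc n) * t"]
        cos_int_2pin[of "int (Suc n)"] sin_int_2pin[of "int (Suc n)"]
      by (simp add: right_diff_distrib mult_ac del: of_nat_Suc)
    then have "G t = G (2 * pi - t)" by (simp add: G_def)
    with G[of "2 * pi - t"] False assms show ?thesis by (simp add: power2_commute)
  qed (use G assms in auto)
  with summable_cos_squares[of t] show ?thesis by (simp add: G_def sums_iff)
qed

subsection \<open>Fourier series of hat functions\<close>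

text \<open>Term \<open>n\<close> merges the frequencies \<open>Suc n\<close> and
  \<open>- Suc n\<close>. The frequency 0 is kept apart and appears as \<open>u ^ r\<close> in
  \<open>hat_series\<close>.\<close>

definition hat_term :: "nat \<Rightarrow> real \<Rightarrow> real \<Rightarrow> nat \<Rightarrow> real"
  where "hat_term r u x n =
    2 * (sin (pi * real (Suc n) * u) / (pi * real (Suc n))) ^ r * cos (2 * pi * real (Suc n) * x)"

text \<open>The bound is uniform in \<open>u\<close> and \<open>x\<close>, so it serves as majorant
  both for uniform convergence and for termwise integration.\<close>

lemma abs_hat_term_le:
  assumes "2 \<le> r"
  shows "\<bar>hat_term r u x n\<bar> \<le> 2 / real (Suc n) ^ 2"
proof -
  let ?q = "sin (pi * real (Suc n) * u) / (pi * real (Suc n))"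
  have q: "\<bar>?q\<bar> \<le> 1 / real (Suc n)"
  proof -
    have "\<bar>?q\<bar> = \<bar>sin (pi * real (Suc n) * u)\<bar> / (pi * real (Suc n))"
      by (simp add: abs_mult del: of_nat_Suc)
    also have "\<dots> \<le> 1 / (1 * real (Suc n))"
      using pi_ge_two by (intro frac_le mult_right_mono) auto
    finally show ?thesis by simp
  qed
  have "\<bar>?q ^ r\<bar> \<le> (1 / real (Suc n)) ^ r"
    unfolding power_abs using q by (rule power_mono) simp
  also have "\<dots> \<le> (1 / real (Suc n)) ^ 2"
    using assms by (intro power_decreasing) auto
  finally have "\<bar>?q ^ r\<bar> * \<bar>cos (2 * pi * real (Suc n) * x)\<bar> \<le> (1 / real (Suc n)) ^ 2 * 1"
    by (intro mult_mono) auto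
  then show ?thesis
    unfolding hat_term_def abs_mult by (simp add: power_one_over del: of_nat_Suc)
qed

lemma summable_two_over_squares: "summable (\<lambda>n. 2 / real (Suc n) ^ 2)"
  using summable_mult[of "\<lambda>n. 1 / real (Suc n) ^ 2" 2] inverse_squares_sums
  by (simp add: sums_iff)

lemma summable_hat_term: "2 \<le> r \<Longrightarrow> summable (\<lambda>n. \<bar>hat_term r u x n\<bar>)"
  by (rule summable_comparison_test'[OF summable_two_over_squares, of 0])
     (simp add: abs_hat_term_le del: of_nat_Suc)

definition hat_series :: "nat \<Rightarrow> real \<Rightarrow> real \<Rightarrow> real"
  where "hat_series r u x = u ^ r + (\<Sum>n. hat_term r u x n)"

lemma continuous_on_hat_series:
  assumes "2 \<le> r"
  shows "continuous_on UNIV (hat_series r u)"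
proof -
  have "continuous_on UNIV (\<lambda>x. \<Sum>n. hat_term r u x n)"
  proof (rule uniform_limit_theorem)
    show "uniform_limit UNIV (\<lambda>m t. \<Sum>n<m. hat_term r u t n) (\<lambda>t. \<Sum>n. hat_term r u t n) sequentially"
      by (rule Weierstrass_m_test[OF _ summable_two_over_squares])
         (use abs_hat_term_le[OF assms] in simp)
  qed (auto intro!: always_eventually continuous_intros simp: hat_term_def)
  then show ?thesis
    unfolding hat_series_def by (intro continuous_intros)
qed

text \<open>The previous series rescaled to period 1, with
  \<open>t = 2 * pi * \<bar>x\<bar>\<close>; the value is the second Bernoulli polynomial at
  \<open>\<bar>x\<bar>\<close>.\<close>

lemma cos_squares_sums_abs:
  assumes "\<bar>x\<bar> \<le> 1"
  shows "(\<lambda>n. cos (2 * pi * real (Suc n) * x) / (pi * real (Suc n)) ^ 2) sums (x\<^sup>2 - \<bar>x\<bar> + 1 / 6)"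
proof -
  have "(\<lambda>n. cos (real (Suc n) * (2 * pi * \<bar>x\<bar>)) / real (Suc n) ^ 2)
      sums ((pi - 2 * pi * \<bar>x\<bar>)\<^sup>2 / 4 - pi\<^sup>2 / 12)"
    using assms by (intro cos_squares_sums) auto
  from sums_divide[OF this, of "pi\<^sup>2"]
  have "(\<lambda>n. cos (real (Suc n) * (2 * pi * \<bar>x\<bar>)) / real (Suc n) ^ 2 / pi\<^sup>2)
      sums (((pi - 2 * pi * \<bar>x\<bar>)\<^sup>2 / 4 - pi\<^sup>2 / 12) / pi\<^sup>2)" .
  moreover have "((pi - 2 * pi * \<bar>x\<bar>)\<^sup>2 / 4 - pi\<^sup>2 / 12) / pi\<^sup>2 = x\<^sup>2 - \<bar>x\<bar> + 1 / 6"
    by (simp add: field_simps power2_eq_square)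
  moreover have "cos (real (Suc n) * (2 * pi * \<bar>x\<bar>)) / real (Suc n) ^ 2 / pi\<^sup>2
      = cos (2 * pi * real (Suc n) * x) / (pi * real (Suc n)) ^ 2" for n
  proof -
    have "cos (real (Suc n) * (2 * pi * \<bar>x\<bar>)) = cos \<bar>2 * pi * real (Suc n) * x\<bar>"
      by (simp add: abs_mult mult_ac del: of_nat_Suc)
    then show ?thesis
      by (simp add: power_mult_distrib mult_ac del: of_nat_Suc)
  qed
  ultimately show ?thesis by simp
qed

text \<open>The product of the squared sine and the cosine is a second difference with step
  \<open>u\<close>, so the series is a second difference of Bernoulli polynomials. Their quadratic
  parts cancel against \<open>u\<^sup>2\<close>, leaving only absolute values. The condition on
  \<open>x\<close> keeps \<open>x + u\<close> and \<open>x - u\<close> in [-1, 1], where the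
  polynomial formula holds.\<close>

lemma hat_series_2:
  assumes "0 \<le> u" "\<bar>x\<bar> \<le> 1 - u"
  shows "hat_series 2 u x = max 0 (u - \<bar>x\<bar>)"
proof -
  let ?c = "\<lambda>x n. cos (2 * pi * real (Suc n) * x) / (pi * real (Suc n)) ^ 2"
  have "hat_term 2 u x n = ?c x n - (?c (x + u) n + ?c (x - u) n) / 2" for n
  proof -
    let ?k = "pi * real (Suc n)"
    have k: "2 * pi * real (Suc n) * (x + u) = 2 * (?k * x) + 2 * (?k * u)"
      "2 * pi * real (Suc n) * (x - u) = 2 * (?k * x) - 2 * (?k * u)"
      "2 * pi * real (Suc n) * x = 2 * (?k * x)"
      by (simp_all add: algebra_simps)
    have "2 * (sin (?k * u))\<^sup>2 = 1 - cos (2 * (?k * u))"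
      using cos_double_sin[of "?k * u"] by simp
    then have "hat_term 2 u x n = (1 - cos (2 * (?k * u))) * cos (2 * (?k * x)) / ?k ^ 2"
      unfolding hat_term_def k by (simp add: power_divide del: of_nat_Suc)
    also have "(1 - cos (2 * (?k * u))) * cos (2 * (?k * x))
       = cos (2 * (?k * x)) - (cos (2 * (?k * x) + 2 * (?k * u)) + cos (2 * (?k * x) - 2 * (?k * u))) / 2"
      unfolding cos_add cos_diff by (simp add: algebra_simps)
    finally show ?thesis unfolding k by (simp only: add_divide_distrib diff_divide_distrib) simp
  qed
  moreover have "(\<lambda>n. ?c x n - (?c (x + u) n + ?c (x - u) n) / 2) sums
     ((x\<^sup>2 - \<bar>x\<bar> + 1 / 6) - (((x + u)\<^sup>2 - \<bar>x + u\<bar> + 1 / 6) + ((x - u)\<^sup>2 - \<bar>x - u\<bar> + 1 / 6)) / 2)"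
    using assms by (intro sums_diff sums_divide sums_add cos_squares_sums_abs) auto
  ultimately have "hat_series 2 u x = u\<^sup>2 +
     ((x\<^sup>2 - \<bar>x\<bar> + 1 / 6) - (((x + u)\<^sup>2 - \<bar>x + u\<bar> + 1 / 6) + ((x - u)\<^sup>2 - \<bar>x - u\<bar> + 1 / 6)) / 2)"
    by (simp add: hat_series_def sums_iff)
  also have "\<dots> = (\<bar>x + u\<bar> + \<bar>x - u\<bar>) / 2 - \<bar>x\<bar>"
    by (simp add: power2_eq_square field_simps)
  also have "\<dots> = max 0 (u - \<bar>x\<bar>)" using assms by (auto simp: max_def abs_if)
  finally show ?thesis .
qed

section \<open>Hat functions near the origin: support and agreement with the series\<close>

lemma hat_2:
  assumes "0 < u"
  shows "hat 2 u x = max 0 (u - \<bar>x\<bar>)"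
proof -
  have "hat 2 u x = (LINT y|lborel. indicator {- u / 2 ..< u / 2} y * indicator {- u / 2 ..< u / 2} (x - y))"
    by (simp add: numeral_2_eq_2 real_convolution_def)
  \<comment> \<open>The integrand is the indicator of the overlap of two intervals of length
    \<open>u\<close> with centres 0 and \<open>x\<close>, so the integral is the length of that
    overlap.\<close>
  also have "\<dots> = (LINT y|lborel. indicator ({- u / 2 ..< u / 2} \<inter> {x - u / 2 <.. x + u / 2}) y)"
    by (intro Bochner_Integration.integral_cong) (auto simp: indicator_def)
  also have "\<dots> = measure lborel ({- u / 2 ..< u / 2} \<inter> {x - u / 2 <.. x + u / 2})"
    by simp
  also have "\<dots> = max 0 (u - \<bar>x\<bar>)"
  proof (cases "x \<ge> 0")
    case True
    then have "{- u / 2 ..< u / 2} \<inter> {x - u / 2 <.. x + u / 2} = {x - u / 2 <..< u / 2}"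
      using assms by auto
    then show ?thesis using True by (cases "x \<le> u") auto
  next
    case False
    then have "{- u / 2 ..< u / 2} \<inter> {x - u / 2 <.. x + u / 2} = {- u / 2 .. x + u / 2}"
      using assms by auto
    then show ?thesis using False by (cases "- u \<le> x") auto
  qed
  finally show ?thesis .
qed

text \<open>Passing from \<open>x - y\<close> to \<open>y\<close> reflects the half-open interval,
  which becomes open on the left and closed on the right.\<close>

lemma hat_Suc:
  assumes "2 \<le> r"
  shows "hat (Suc r) u x = (LINT y|lborel. indicator {x - u / 2 <.. x + u / 2} y * hat r u y)"
proof -
  obtain s where r: "r = Suc (Suc s)" using assms by (metis add_2_eq_Suc le_Suc_ex)
  have "hat (Suc r) u x = (LINT y|lborel. hat r u y * indicator {- u / 2 ..< u / 2} (x - y))"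
    by (simp add: r real_convolution_def)
  also have "\<dots> = (LINT y|lborel. indicator {x - u / 2 <.. x + u / 2} y * hat r u y)"
    by (intro Bochner_Integration.integral_cong) (auto simp: indicator_def)
  finally show ?thesis .
qed

text \<open>Each convolution widens the support by \<open>u / 2\<close> on both sides. For
  \<open>x\<close> this far out, the averaging window does not reach the interior of the support of
  the previous order.\<close>

lemma hat_eq_0:
  assumes "2 \<le> r" "0 < u" "real r * u / 2 \<le> \<bar>x\<bar>"
  shows "hat r u x = 0"
  using assms(1,3)
proof (induction r arbitrary: x rule: dec_induct)
  case base
  then show ?case using hat_2[OF assms(2)] by simp
next
  case (step r)
  \<comment> \<open>The induction hypothesis is applied inside the open window; the remaining point
    \<open>x + u / 2\<close> is a null set.\<close>
  have "indicator {x - u / 2 <.. x + u / 2} y * hat r u y = indicator {x + u / 2} y * hat r u y" for y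
  proof (cases "y \<in> {x - u / 2 <..< x + u / 2}")
    case True
    then have "real r * u / 2 \<le> \<bar>y\<bar>" using step.prems by (auto simp: algebra_simps abs_if split: if_splits)
    then show ?thesis using True step.IH by simp
  qed (use assms in \<open>auto simp: indicator_def\<close>)
  then have "hat (Suc r) u x = (LINT y|lborel. indicator {x + u / 2} y * hat r u y)"
    unfolding hat_Suc[OF step.hyps(1)] by (simp only:)
  also have "\<dots> = 0"
  proof (rule integral_eq_zero_AE)
    show "AE y in lborel. indicator {x + u / 2} y * hat r u y = 0"
      using AE_lborel_singleton[of "x + u / 2"] by eventually_elim (simp add: indicator_def)
  qed
  finally show ?case .
qed

text \<open>Termwise integration with the uniform majorant. The translation \<open>s\<close> is
  carried along for the integral of a shifted series over a period.\<close>

lemma hat_term_integral_sums: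
  assumes "2 \<le> r" "a \<le> b"
  shows "(\<lambda>n. LINT y|lborel. indicator {a..b} y *\<^sub>R hat_term r u (y - s) n)
           sums (LINT y|lborel. indicator {a..b} y *\<^sub>R (\<Sum>n. hat_term r u (y - s) n))"
proof -
  have int: "integrable lborel (\<lambda>y. indicator {a..b} y *\<^sub>R hat_term r u (y - s) n)" for n
    by (intro borel_integrable_compact) (auto simp: hat_term_def intro!: continuous_intros)
  have "(\<lambda>n. LINT y|lborel. indicator {a..b} y *\<^sub>R hat_term r u (y - s) n)
           sums (LINT y|lborel. (\<Sum>n. indicator {a..b} y *\<^sub>R hat_term r u (y - s) n))"
  proof (rule sums_integral[OF int])
    show "AE y in lborel. summable (\<lambda>n. norm (indicator {a..b} y *\<^sub>R hat_term r u (y - s) n))"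
    proof (rule AE_I2)
      fix y show "summable (\<lambda>n. norm (indicator {a..b} y *\<^sub>R hat_term r u (y - s) n))"
        using summable_mult[OF summable_hat_term[OF assms(1)], of "indicator {a..b} y" u "y - s"]
        by (simp add: abs_mult)
    qed
    show "summable (\<lambda>n. LINT y|lborel. norm (indicator {a..b} y *\<^sub>R hat_term r u (y - s) n))"
    proof (rule summable_comparison_test'[OF summable_mult[OF summable_two_over_squares, of "b - a"], of 0])
      fix n
      have "(LINT y|lborel. norm (indicator {a..b} y *\<^sub>R hat_term r u (y - s) n))
          \<le> (LINT y|lborel. indicator {a..b} y *\<^sub>R (2 / real (Suc n) ^ 2))"
      proof (rule integral_mono)
        show "integrable lborel (\<lambda>y. indicator {a..b} y *\<^sub>R (2 / real (Suc n) ^ 2))"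
          by (intro borel_integrable_compact) auto
        show "norm (indicator {a..b} y *\<^sub>R hat_term r u (y - s) n)
            \<le> indicator {a..b} y *\<^sub>R (2 / real (Suc n) ^ 2)" for y
          using abs_hat_term_le[OF assms(1), of u "y - s" n] by (simp add: indicator_def del: of_nat_Suc)
      qed (intro integrable_norm int)
      also have "\<dots> = (b - a) * (2 / real (Suc n) ^ 2)"
        using assms by simp
      finally show "norm (LINT y|lborel. norm (indicator {a..b} y *\<^sub>R hat_term r u (y - s) n))
         \<le> (b - a) * (2 / real (Suc n) ^ 2)" by simp
    qed
  qed
  also have "(\<lambda>y. \<Sum>n. indicator {a..b} y *\<^sub>R hat_term r u (y - s) n)
      = (\<lambda>y. indicator {a..b} y *\<^sub>R (\<Sum>n. hat_term r u (y - s) n))"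
    by (auto simp: indicator_def fun_eq_iff)
  finally show ?thesis .
qed

lemma hat_term_integral:
  assumes "a \<le> b"
  shows "(LINT y|lborel. indicator {a..b} y *\<^sub>R hat_term r u (y - s) n)
    = (sin (pi * real (Suc n) * u) / (pi * real (Suc n))) ^ r / (pi * real (Suc n))
      * (sin (2 * pi * real (Suc n) * (b - s)) - sin (2 * pi * real (Suc n) * (a - s)))"
proof -
  let ?F = "\<lambda>y. (sin (pi * real (Suc n) * u) / (pi * real (Suc n))) ^ r / (pi * real (Suc n))
      * sin (2 * pi * real (Suc n) * (y - s))"
  have "(LINT y|lborel. indicator {a..b} y *\<^sub>R hat_term r u (y - s) n) = ?F b - ?F a"
  proof (rule integral_FTC_atLeastAtMost[OF assms, where F = ?F])
    fix y
    show "(?F has_vector_derivative hat_term r u (y - s) n) (at y within {a..b})"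
      unfolding has_real_derivative_iff_has_vector_derivative[symmetric] hat_term_def
      by (auto intro!: derivative_eq_intros simp del: of_nat_Suc)
  qed (auto simp: hat_term_def intro!: continuous_intros)
  then show ?thesis by (simp only: right_diff_distrib)
qed

lemma hat_series_integral:
  assumes "2 \<le> r" "a \<le> b"
  shows "(LINT y|lborel. indicator {a..b} y *\<^sub>R hat_series r u (y - s))
    = (b - a) * u ^ r + (\<Sum>n. LINT y|lborel. indicator {a..b} y *\<^sub>R hat_term r u (y - s) n)"
proof -
  have c: "continuous_on {a..b} (\<lambda>y. hat_series r u (y - s))"
    by (rule continuous_on_compose2[OF continuous_on_hat_series[OF assms(1)]]) (auto intro!: continuous_intros)
  have 1: "integrable lborel (\<lambda>y. indicator {a..b} y *\<^sub>R u ^ r)"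
    by (intro borel_integrable_compact) auto
  have "continuous_on {a..b} (\<lambda>y. hat_series r u (y - s) - u ^ r)"
    by (intro continuous_intros c)
  then have "integrable lborel (\<lambda>y. indicator {a..b} y *\<^sub>R (\<Sum>n. hat_term r u (y - s) n))"
    unfolding hat_series_def by (intro borel_integrable_compact) auto
  from Bochner_Integration.integral_add[OF 1 this] show ?thesis
    using sums_unique[OF hat_term_integral_sums[OF assms, of u s]] assms
    by (simp add: hat_series_def distrib_left)
qed

text \<open>Over a full period the antiderivative of each oscillating term takes equal boundary
  values, so only the coefficient of frequency 0 survives.\<close>

lemma hat_series_integral_period:
  assumes "2 \<le> r"
  shows "(LINT y|lborel. indicator {0..1} y *\<^sub>R hat_series r u (y - s)) = u ^ r"
proof -
  have "sin (2 * pi * real (Suc n) * (1 - s)) = sin (2 * pi * real (Suc n) * (0 - s))" for n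
    using sin_add[of "2 * pi * real (Suc n)" "2 * pi * real (Suc n) * (0 - s)"]
      cos_int_2pin[of "int (Suc n)"] sin_int_2pin[of "int (Suc n)"]
    by (simp add: algebra_simps del: of_nat_Suc)
  then have "(LINT y|lborel. indicator {0..1} y *\<^sub>R hat_term r u (y - s) n) = 0" for n
    by (subst hat_term_integral) auto
  then show ?thesis using hat_series_integral[OF assms, of 0 1 u s] by simp
qed

text \<open>Averaging a cosine over the window produces sin (A + B) - sin (A - B) = 2 cos A sin B,
  which multiplies the coefficient of frequency k by sin (pi k u) / (pi k) and so raises the
  exponent from \<open>r\<close> to \<open>Suc r\<close>.\<close>

lemma hat_series_Suc:
  assumes "2 \<le> r" "0 < u"
  shows "(LINT y|lborel. indicator {x - u / 2..x + u / 2} y *\<^sub>R hat_series r u y) = hat_series (Suc r) u x"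
proof -
  have "(LINT y|lborel. indicator {x - u / 2..x + u / 2} y *\<^sub>R hat_term r u y n) = hat_term (Suc r) u x n" for n
  proof -
    let ?A = "2 * pi * real (Suc n) * x" and ?B = "pi * real (Suc n) * u"
    have "2 * pi * real (Suc n) * (x + u / 2 - 0) = ?A + ?B"
      "2 * pi * real (Suc n) * (x - u / 2 - 0) = ?A - ?B"
      by (simp_all add: algebra_simps)
    then show ?thesis
      using hat_term_integral[of "x - u / 2" "x + u / 2" r u 0 n] assms
      by (simp add: hat_term_def sin_add sin_diff)
  qed
  then show ?thesis
    using hat_series_integral[OF assms(1), of "x - u / 2" "x + u / 2" u 0] assms
    by (simp add: hat_series_def)
qed

text \<open>Both sides obey the same averaging recursion. The admissible range of \<open>x\<close>
  shrinks by \<open>u / 2\<close> with each order, exactly the reach of the window. On this range no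
  other integer translate of the hat contributes.\<close>

lemma hat_eq_series:
  assumes "2 \<le> r" "0 < u" "\<bar>x\<bar> \<le> 1 - real r * u / 2"
  shows "hat r u x = hat_series r u x"
  using assms(1,3)
proof (induction r arbitrary: x rule: dec_induct)
  case base
  then show ?case using hat_2[OF assms(2)] hat_series_2[of u x] assms(2) by simp
next
  case (step r)
  let ?I = "{x - u / 2 <.. x + u / 2}"
  have [measurable]: "hat_series r u \<in> borel_measurable borel"
    using continuous_on_hat_series[OF step.hyps(1)] by (rule borel_measurable_continuous_onI)
  have "indicator ?I y * hat r u y = indicator ?I y * hat_series r u y" for y
  proof (cases "y \<in> ?I")
    case True
    then have "\<bar>y\<bar> \<le> \<bar>x\<bar> + u / 2" by (auto simp: abs_if)
    moreover have "real (Suc r) * u / 2 = real r * u / 2 + u / 2" by (simp add: algebra_simps add_divide_distrib)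
    ultimately have "\<bar>y\<bar> \<le> 1 - real r * u / 2" using step.prems by linarith
    then show ?thesis using step.IH by simp
  qed simp
  then have "hat (Suc r) u x = (LINT y|lborel. indicator ?I y * hat_series r u y)"
    unfolding hat_Suc[OF step.hyps(1)] by (simp only:)
  also have "\<dots> = (LINT y|lborel. indicator {x - u / 2..x + u / 2} y *\<^sub>R hat_series r u y)"
  proof (rule Bochner_Integration.integral_cong_AE)
    show "AE y in lborel. indicator ?I y * hat_series r u y
        = indicator {x - u / 2..x + u / 2} y *\<^sub>R hat_series r u y"
      using AE_lborel_singleton[of "x - u / 2"] by eventually_elim (auto simp: indicator_def)
  qed simp_all
  also have "\<dots> = hat_series (Suc r) u x"
    by (rule hat_series_Suc[OF step.hyps(1) assms(2)])
  finally show ?case .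
qed

lemma hat_series_periodic: "hat_series r u (x + of_int k) = hat_series r u x"
proof -
  have "cos (2 * pi * real (Suc n) * (x + of_int k)) = cos (2 * pi * real (Suc n) * x)" for n
    using cos_add[of "2 * pi * real (Suc n) * x" "2 * pi * (of_int (int (Suc n) * k))"]
      cos_int_2pin[of "int (Suc n) * k"] sin_int_2pin[of "int (Suc n) * k"]
    by (simp add: algebra_simps del: of_nat_Suc)
  then show ?thesis by (simp add: hat_series_def hat_term_def)
qed

subsection \<open>Dyadic sums\<close>

text \<open>A geometric series with ratio \<open>2 powr - \<theta>\<close>, compared from the
  smallest index \<open>m\<close> that satisfies the condition.\<close>

lemma sum_dyadic_powr_le:
  fixes u B \<theta> :: real
  assumes "finite I" "0 < u" "0 < B" "0 < \<theta>"
  shows "(\<Sum>i | i \<in> I \<and> B \<le> 2 ^ i * u. (2 ^ i * u) powr - \<theta>) \<le> B powr - \<theta> / (1 - 2 powr - \<theta>)"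
proof -
  define I' where "I' = {i \<in> I. B \<le> 2 ^ i * u}"
  define q where "q = 2 powr - \<theta>"
  have q: "0 < q" "q < 1" using assms by (auto simp: q_def powr_less_one)
  have fin: "finite I'" using assms by (simp add: I'_def)
  show ?thesis
  proof (cases "I' = {}")
    case True
    have "0 \<le> B powr - \<theta> / (1 - q)" using q by simp
    with True show ?thesis unfolding I'_def[symmetric] q_def by simp
  next
    case False
    define m where "m = Min I'"
    have m: "m \<in> I'" "\<And>i. i \<in> I' \<Longrightarrow> m \<le> i" using fin False by (auto simp: m_def)
    have "(\<Sum>i\<in>I'. (2 ^ i * u) powr - \<theta>) \<le> (\<Sum>i\<in>I'. B powr - \<theta> * q ^ (i - m))"
    proof (rule sum_mono)
      fix i assume "i \<in> I'"
      with m have "i = m + (i - m)" by simp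
      then have "2 ^ i * u = (2 ^ m * u) * 2 ^ (i - m)" by (metis mult.assoc mult.commute power_add)
      then have "(2 ^ i * u) powr - \<theta> = (2 ^ m * u) powr - \<theta> * (2 ^ (i - m)) powr - \<theta>"
        using assms by (simp add: powr_mult)
      also have "(2 ^ (i - m)) powr - \<theta> = q ^ (i - m)"
        by (simp add: q_def powr_realpow[symmetric] powr_powr powr_power mult.commute)
      also have "(2 ^ m * u) powr - \<theta> \<le> B powr - \<theta>"
        using m(1) assms by (intro powr_mono2') (auto simp: I'_def)
      finally show "(2 ^ i * u) powr - \<theta> \<le> B powr - \<theta> * q ^ (i - m)"
        using q by (simp add: mult_right_mono)
    qed
    also have "\<dots> = B powr - \<theta> * (\<Sum>l\<in>(\<lambda>i. i - m) ` I'. q ^ l)"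
    proof (subst sum.reindex)
      show "inj_on (\<lambda>i. i - m) I'" using m(2) by (meson eq_diff_iff inj_onI)
    qed (simp add: sum_distrib_left)
    also have "\<dots> \<le> B powr - \<theta> * (1 / (1 - q))"
    proof (rule mult_left_mono)
      have "(\<Sum>l\<in>(\<lambda>i. i - m) ` I'. q ^ l) \<le> (\<Sum>l. q ^ l)"
        using q fin by (intro sum_le_suminf summable_geometric) auto
      then show "(\<Sum>l\<in>(\<lambda>i. i - m) ` I'. q ^ l) \<le> 1 / (1 - q)"
        using q by (simp add: suminf_geometric)
    qed simp
    finally show ?thesis unfolding I'_def[symmetric] q_def by simp
  qed
qed

text \<open>A geometric sum of ratio 2 is at most twice its largest term, and that term is at most
  1.\<close>

lemma sum_dyadic_le:
  fixes u :: real
  assumes "finite I" "0 < u"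
  shows "(\<Sum>i | i \<in> I \<and> 2 ^ i * u \<le> 1. 2 ^ i * u) \<le> 2"
proof -
  define I' where "I' = {i \<in> I. 2 ^ i * u \<le> 1}"
  have fin: "finite I'" using assms by (simp add: I'_def)
  show ?thesis
  proof (cases "I' = {}")
    case False
    define m where "m = Max I'"
    have m: "m \<in> I'" "\<And>i. i \<in> I' \<Longrightarrow> i \<le> m" using fin False by (auto simp: m_def)
    have "(\<Sum>i\<in>I'. 2 ^ i * u) \<le> (\<Sum>i<Suc m. 2 ^ i * u)"
      using m assms by (intro sum_mono2) (auto simp: less_Suc_eq_le)
    also have "\<dots> = (2 ^ Suc m - 1) * u"
      by (simp add: sum_distrib_right[symmetric] geometric_sum)
    also have "\<dots> \<le> 2 * (2 ^ m * u)" using assms by (simp add: algebra_simps)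
    also have "\<dots> \<le> 2" using m(1) by (simp add: I'_def)
    finally show ?thesis unfolding I'_def .
  qed (simp add: I'_def[symmetric])
qed

text \<open>By convexity the chord of the exponential between \<open>- ln 2\<close> and 0 lies above
  the graph. This bounds the geometric series of ratio \<open>2 powr - \<delta>\<close> by
  \<open>2 / \<delta>\<close>.\<close>

lemma two_powr_minus_le:
  fixes \<delta> :: real
  assumes "0 \<le> \<delta>" "\<delta> \<le> 1"
  shows "2 powr - \<delta> \<le> 1 - \<delta> / 2"
proof -
  have "exp ((1 - \<delta>) *\<^sub>R 0 + \<delta> *\<^sub>R (- ln 2)) \<le> (1 - \<delta>) * exp 0 + \<delta> * exp (- ln (2::real))"
    using assms by (intro convex_onD[OF exp_convex]) auto
  then show ?thesis by (simp add: powr_def exp_minus field_simps)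
qed

text \<open>Split where \<open>2 ^ i * u\<close> passes 1: the lower part is at most 2 and the upper
  part is a geometric series costing \<open>2 / \<delta>\<close>. With \<open>\<delta>\<close> the
  reciprocal of a logarithm, one such sum costs one logarithm.\<close>

lemma sum_dyadic_min_powr_le:
  fixes u \<delta> :: real
  assumes "finite I" "0 < u" "0 < \<delta>" "\<delta> \<le> 1"
  shows "(\<Sum>i\<in>I. min (2 ^ i * u) (1 / (2 ^ i * u)) * (2 ^ i * u) powr (1 - \<delta>)) \<le> 4 / \<delta>"
proof -
  let ?x = "\<lambda>i. 2 ^ i * u"
  have pos: "0 < ?x i" for i using assms by simp
  have "(\<Sum>i\<in>I. min (?x i) (1 / ?x i) * ?x i powr (1 - \<delta>))
     \<le> (\<Sum>i\<in>I. (if ?x i \<le> 1 then ?x i else 0) + (if 1 \<le> ?x i then ?x i powr - \<delta> else 0))"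
  proof (rule sum_mono)
    fix i
    show "min (?x i) (1 / ?x i) * ?x i powr (1 - \<delta>)
      \<le> (if ?x i \<le> 1 then ?x i else 0) + (if 1 \<le> ?x i then ?x i powr - \<delta> else 0)"
    proof (cases "?x i \<le> 1")
      case True
      then have "?x i powr (1 - \<delta>) \<le> 1" using assms pos[of i] by (intro powr_le1) auto
      then have "min (?x i) (1 / ?x i) * ?x i powr (1 - \<delta>) \<le> ?x i * 1"
        using pos[of i] by (intro mult_mono) auto
      then show ?thesis using True by (auto intro: order_trans)
    next
      case False
      have "min (?x i) (1 / ?x i) * ?x i powr (1 - \<delta>) \<le> 1 / ?x i * ?x i powr (1 - \<delta>)"
        by (intro mult_right_mono) auto
      also have "\<dots> = ?x i powr - \<delta>"
        using pos[of i] by (simp add: powr_diff powr_minus field_simps)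
      finally show ?thesis using False by simp
    qed
  qed
  also have "\<dots> = (\<Sum>i | i \<in> I \<and> ?x i \<le> 1. ?x i) + (\<Sum>i | i \<in> I \<and> 1 \<le> ?x i. ?x i powr - \<delta>)"
    using assms(1) by (simp add: sum.distrib sum.inter_filter)
  also have "\<dots> \<le> 2 + 1 powr - \<delta> / (1 - 2 powr - \<delta>)"
    using assms by (intro add_mono sum_dyadic_le sum_dyadic_powr_le) auto
  also have "\<dots> \<le> 2 + 1 / (\<delta> / 2)"
    unfolding powr_one_eq_one using two_powr_minus_le[of \<delta>] assms by (intro add_left_mono frac_le) auto
  also have "\<dots> \<le> 4 / \<delta>" using assms by (simp add: field_simps)
  finally show ?thesis .
qed

text \<open>For \<open>B \<le> 1\<close> the whole sum is at most 4; for larger \<open>B\<close> the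
  tail is at most \<open>2 / B\<close>. Both are covered by any power \<open>p\<close> between 0 and
  1.\<close>

lemma sum_dyadic_min_tail_le:
  fixes u p B :: real
  assumes "finite I" "0 < u" "0 < B" "0 \<le> p" "p \<le> 1"
  shows "(\<Sum>i | i \<in> I \<and> B \<le> 2 ^ i * u. min (2 ^ i * u) (1 / (2 ^ i * u))) \<le> 4 * (1 / B) powr p"
proof (cases "B \<le> 1")
  case True
  let ?x = "\<lambda>i. 2 ^ i * u"
  have pos: "0 < ?x i" for i using assms by simp
  have "(\<Sum>i | i \<in> I \<and> B \<le> ?x i. min (?x i) (1 / ?x i)) \<le> (\<Sum>i\<in>I. min (?x i) (1 / ?x i))"
    using assms pos by (intro sum_mono2) (auto intro: less_imp_le)
  also have "\<dots> = (\<Sum>i\<in>I. min (?x i) (1 / ?x i) * ?x i powr (1 - 1))"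
    using pos by (simp add: less_imp_neq[OF pos, symmetric])
  also have "\<dots> \<le> 4" using sum_dyadic_min_powr_le[of I u 1] assms by simp
  also have "\<dots> \<le> 4 * (1 / B) powr p"
    using True assms by (simp add: ge_one_powr_ge_zero)
  finally show ?thesis .
next
  case False
  have "(\<Sum>i | i \<in> I \<and> B \<le> 2 ^ i * u. min (2 ^ i * u) (1 / (2 ^ i * u)))
      \<le> (\<Sum>i | i \<in> I \<and> B \<le> 2 ^ i * u. (2 ^ i * u) powr - 1)"
    using assms by (intro sum_mono) (simp add: powr_minus_divide)
  also have "\<dots> \<le> B powr - 1 / (1 - 2 powr - 1)"
    using assms by (intro sum_dyadic_powr_le) auto
  also have "\<dots> = 2 * (1 / B) powr 1" using assms by (simp add: powr_minus_divide)
  also have "\<dots> \<le> 4 * (1 / B) powr p"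
    using assms False by (intro mult_mono powr_mono') auto
  finally show ?thesis .
qed

text \<open>One coordinate is summed first and absorbs the constraint. Its tail bound is a power of
  the product of the other coordinates, so the remaining sum factorizes; hence the exponent
  \<open>CARD('n) - 1\<close>.\<close>

lemma sum_dyadic_box_tail_le:
  fixes u :: "'n::finite \<Rightarrow> real" and S :: "('n \<Rightarrow> nat) set"
  assumes "finite S" and u: "\<And>j. 0 < u j" and "0 < A" "A \<le> V" "exp 1 \<le> V"
    and tail: "\<And>s. s \<in> S \<Longrightarrow> A \<le> (\<Prod>j\<in>UNIV. 2 ^ s j * u j)"
  shows "(\<Sum>s\<in>S. \<Prod>j\<in>UNIV. min (2 ^ s j * u j) (1 / (2 ^ s j * u j)))
    \<le> 4 * exp 1 / A * (4 * ln V) ^ (CARD('n) - 1)"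
proof -
  have "0 < V" using assms by linarith
  have lnV: "1 \<le> ln V" using assms \<open>0 < V\<close> by (simp add: ln_ge_iff)
  \<comment> \<open>This choice makes \<open>V powr \<delta>\<close> equal to \<open>exp 1\<close>,
    while each remaining coordinate costs \<open>4 / \<delta> = 4 * ln V\<close>.\<close>
  define \<delta> where "\<delta> = 1 / ln V"
  have \<delta>: "0 < \<delta>" "\<delta> \<le> 1" using lnV by (auto simp: \<delta>_def)
  define x where "x = (\<lambda>j i. 2 ^ i * u j)"
  define w where "w = (\<lambda>j i. min (x j i) (1 / x j i))"
  have x: "0 < x j i" for j i using u by (simp add: x_def)
  have w: "0 < w j i" for j i using x by (simp add: w_def)
  define j0 :: 'n where "j0 = undefined"
  define J where "J = UNIV - {j0}"
  have J: "finite J" "j0 \<notin> J" "insert j0 J = UNIV" by (auto simp: J_def)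
  define I where "I = (\<Union>s\<in>S. range s)"
  have finI: "finite I" using assms(1) by (simp add: I_def)
  define T where "T = PiE J (\<lambda>_. I)"
  have finT: "finite T" using J finI by (simp add: T_def finite_PiE)
  define P where "P = (\<lambda>t. \<Prod>j\<in>J. x j (t j))"
  have P: "0 < P t" for t using x by (simp add: P_def prod_pos)
  have prod_split: "(\<Prod>j\<in>UNIV. f j) = f j0 * (\<Prod>j\<in>J. f j)" for f :: "'n \<Rightarrow> real"
    using prod.insert[OF J(1,2), of f] J(3) by simp
  define h where "h = (\<lambda>s::'n \<Rightarrow> nat. (restrict s J, s j0))"
  have inj: "inj_on h S"
  proof (rule inj_onI)
    fix s s' assume eq: "h s = h s'"
    show "s = s'"
    proof
      fix j show "s j = s' j"
        using eq J(3) by (cases "j = j0") (auto simp: h_def restrict_def J_def dest: fun_cong[of _ _ j])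
    qed
  qed
  \<comment> \<open>All pairs of remaining coordinates \<open>t\<close> and an index
    \<open>i\<close> for \<open>j0\<close> that satisfy the constraint solved for the coordinate
    \<open>j0\<close>.\<close>
  let ?R = "Sigma T (\<lambda>t. {i \<in> I. A / P t \<le> x j0 i})"
  have sub: "h ` S \<subseteq> ?R"
  proof
    fix y assume "y \<in> h ` S"
    then obtain s where s: "s \<in> S" "y = h s" by blast
    have "P (restrict s J) = (\<Prod>j\<in>J. x j (s j))" by (simp add: P_def)
    then have "A \<le> x j0 (s j0) * P (restrict s J)"
      using tail[OF s(1)] by (simp add: prod_split x_def)
    then have "A / P (restrict s J) \<le> x j0 (s j0)"
      using P by (simp add: divide_le_eq)
    then show "y \<in> ?R" using s by (auto simp: h_def T_def I_def)
  qed
  have "(\<Sum>s\<in>S. \<Prod>j\<in>UNIV. w j (s j)) = (\<Sum>(t, i)\<in>h ` S. w j0 i * (\<Prod>j\<in>J. w j (t j)))"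
    by (subst sum.reindex[OF inj]) (simp add: h_def prod_split)
  also have "\<dots> \<le> (\<Sum>(t, i)\<in>?R. w j0 i * (\<Prod>j\<in>J. w j (t j)))"
  proof (rule sum_mono2[OF _ sub])
    show "finite ?R" using finT finI by (intro finite_SigmaI) auto
    show "0 \<le> (case y of (t, i) \<Rightarrow> w j0 i * (\<Prod>j\<in>J. w j (t j)))" for y
      using w by (cases y) (simp add: prod_nonneg less_imp_le)
  qed
  also have "\<dots> = (\<Sum>t\<in>T. (\<Sum>i | i \<in> I \<and> A / P t \<le> x j0 i. w j0 i) * (\<Prod>j\<in>J. w j (t j)))"
    using finT finI by (subst sum.Sigma[symmetric]) (auto simp: sum_distrib_right)
  \<comment> \<open>The tail bound is used with cut-off \<open>A / P t\<close> and exponent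
    \<open>1 - \<delta>\<close>; the power of \<open>P t\<close> splits over
    \<open>J\<close>.\<close>
  also have "\<dots> \<le> (\<Sum>t\<in>T. 4 * A powr (\<delta> - 1) * (\<Prod>j\<in>J. w j (t j) * x j (t j) powr (1 - \<delta>)))"
  proof (rule sum_mono)
    fix t assume "t \<in> T"
    have "(\<Sum>i | i \<in> I \<and> A / P t \<le> x j0 i. w j0 i) \<le> 4 * (1 / (A / P t)) powr (1 - \<delta>)"
      unfolding w_def x_def using finI u P \<delta> assms(3) by (intro sum_dyadic_min_tail_le) auto
    also have "(1 / (A / P t)) powr (1 - \<delta>) = A powr (\<delta> - 1) * P t powr (1 - \<delta>)"
      using P[of t] assms(3) powr_minus_divide[of A "1 - \<delta>"] by (simp add: powr_divide)
    also have "P t powr (1 - \<delta>) = (\<Prod>j\<in>J. x j (t j) powr (1 - \<delta>))"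
      unfolding P_def by (rule prod_powr_distrib)
    finally have "(\<Sum>i | i \<in> I \<and> A / P t \<le> x j0 i. w j0 i) * (\<Prod>j\<in>J. w j (t j))
        \<le> 4 * (A powr (\<delta> - 1) * (\<Prod>j\<in>J. x j (t j) powr (1 - \<delta>))) * (\<Prod>j\<in>J. w j (t j))"
      using w by (intro mult_right_mono prod_nonneg) (auto simp: less_imp_le)
    then show "(\<Sum>i | i \<in> I \<and> A / P t \<le> x j0 i. w j0 i) * (\<Prod>j\<in>J. w j (t j))
        \<le> 4 * A powr (\<delta> - 1) * (\<Prod>j\<in>J. w j (t j) * x j (t j) powr (1 - \<delta>))"
      by (simp add: prod.distrib mult_ac)
  qed
  also have "\<dots> = 4 * A powr (\<delta> - 1) * (\<Prod>j\<in>J. \<Sum>i\<in>I. w j i * x j i powr (1 - \<delta>))"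
    unfolding T_def using J finI by (subst prod_sum_PiE) (auto simp: sum_distrib_left)
  also have "\<dots> \<le> 4 * A powr (\<delta> - 1) * (\<Prod>j\<in>J. 4 / \<delta>)"
  proof (intro mult_left_mono prod_mono conjI)
    fix j
    show "0 \<le> (\<Sum>i\<in>I. w j i * x j i powr (1 - \<delta>))" using w by (intro sum_nonneg) (simp add: less_imp_le)
    show "(\<Sum>i\<in>I. w j i * x j i powr (1 - \<delta>)) \<le> 4 / \<delta>"
      unfolding w_def x_def using finI u \<delta> by (intro sum_dyadic_min_powr_le) auto
  qed auto
  also have "(\<Prod>j\<in>J. 4 / \<delta>) = (4 * ln V) ^ (CARD('n) - 1)"
    by (simp add: J_def \<delta>_def card_Diff_subset)
  also have "4 * A powr (\<delta> - 1) * (4 * ln V) ^ (CARD('n) - 1) \<le> 4 * (exp 1 / A) * (4 * ln V) ^ (CARD('n) - 1)"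
  proof (intro mult_right_mono mult_left_mono)
    have "A powr (\<delta> - 1) = A powr \<delta> / A" using assms(3) by (simp add: powr_diff)
    also have "A powr \<delta> \<le> V powr \<delta>" using assms \<delta> by (intro powr_mono2) auto
    also have "V powr \<delta> = exp 1" using \<open>0 < V\<close> lnV by (auto simp: powr_def \<delta>_def)
    finally show "A powr (\<delta> - 1) \<le> exp 1 / A" using assms(3) by (simp add: divide_right_mono)
  qed (use lnV in auto)
  finally show ?thesis by (simp add: w_def x_def)
qed

subsection \<open>Lattice points in dyadic boxes\<close>

text \<open>Greedy distribution: each inserted element takes as much of the remaining total as its
  cap allows. It chooses the side lengths of a dyadic subbox of prescribed volume.\<close>

lemma exists_le_with_sum:
  fixes s :: "'a \<Rightarrow> nat"
  assumes "finite A" "l \<le> sum s A"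
  shows "\<exists>q. (\<forall>j. q j \<le> s j) \<and> sum q A = l"
  using assms
proof (induction A arbitrary: l rule: finite_induct)
  case empty
  then show ?case by (auto intro: exI[of _ s])
next
  case (insert a A)
  have "l - min l (s a) \<le> sum s A" using insert.prems insert.hyps by auto
  from insert.IH[OF this] obtain q where q: "\<forall>j. q j \<le> s j" "sum q A = l - min l (s a)" by blast
  have "sum (q(a := min l (s a))) A = sum q A"
    using insert.hyps by (intro sum.cong) auto
  then have "sum (q(a := min l (s a))) (insert a A) = l"
    using insert.hyps q by simp
  then show ?case using q(1) by (intro exI[of _ "q(a := min l (s a))"]) auto
qed

text \<open>The quotient labels blocks of length \<open>2 ^ q\<close>; the interval meets at most
  \<open>2 * 2 ^ (s - q)\<close> of them.\<close>

lemma int_div_power_bounds: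
  fixes k :: int
  assumes "\<bar>k\<bar> < 2 ^ s" "q \<le> s"
  shows "k div 2 ^ q \<in> {- (2 ^ (s - q)) ..< 2 ^ (s - q)}"
proof -
  have e: "(2::int) ^ s = 2 ^ (s - q) * 2 ^ q" using assms(2) by (simp add: power_add[symmetric])
  have "- (2 ^ (s - q)) * 2 ^ q \<le> k" using assms(1) e by auto
  then have "(- (2 ^ (s - q)) * 2 ^ q) div 2 ^ q \<le> k div 2 ^ q" by (rule zdiv_mono1) simp
  then have "- (2 ^ (s - q)) \<le> k div 2 ^ q" by (subst (asm) nonzero_mult_div_cancel_right) simp_all
  moreover have "k div 2 ^ q < 2 ^ (s - q)"
  proof (rule ccontr)
    assume "\<not> ?thesis"
    then have "2 ^ (s - q) * 2 ^ q \<le> (k div 2 ^ q) * 2 ^ q" by (intro mult_right_mono) auto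
    also have "\<dots> \<le> k" using pos_mod_sign[of "2 ^ q" k] by (simp add: minus_mod_eq_div_mult[symmetric])
    finally show False using assms(1) e by simp
  qed
  ultimately show ?thesis by simp
qed

lemma abs_diff_less_of_div_eq:
  fixes k k' m :: int
  assumes "k div m = k' div m" "0 < m"
  shows "\<bar>k - k'\<bar> < m"
proof -
  have "k - k' = k mod m - k' mod m"
    using assms(1) by (metis add_diff_cancel_left div_mult_mod_eq)
  then show ?thesis using pos_mod_bound[OF assms(2)] pos_mod_sign[OF assms(2)] by (smt (verit))
qed

text \<open>Cut the box into translates of a dyadic subbox of volume \<open>2 ^ l \<le> L\<close>; each of them
  contains at most one lattice point, since differences would lie in the hyperbolic cross.\<close>

lemma card_lattice_dyadic_box_le:
  fixes M :: "(int ^ 'n::finite) set" and s :: "'n \<Rightarrow> nat"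
  assumes diff: "\<And>k k'. k \<in> M \<Longrightarrow> k' \<in> M \<Longrightarrow> k - k' \<in> hyperbolic_cross L \<Longrightarrow> k = k'"
    and l: "2 ^ l \<le> L" "l \<le> (\<Sum>j\<in>UNIV. s j)"
  shows "finite {k \<in> M. \<forall>j. \<bar>k $ j\<bar> < 2 ^ s j}"
    and "card {k \<in> M. \<forall>j. \<bar>k $ j\<bar> < 2 ^ s j} \<le> 2 ^ CARD('n) * 2 ^ ((\<Sum>j\<in>UNIV. s j) - l)"
proof -
  let ?K = "{k \<in> M. \<forall>j. \<bar>k $ j\<bar> < 2 ^ s j}"
  obtain q where q: "\<And>j. q j \<le> s j" "(\<Sum>j\<in>UNIV. q j) = l"
    using exists_le_with_sum[OF _ l(2)] by auto
  define h where "h = (\<lambda>(k::int^'n) j. k $ j div 2 ^ q j)"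
  let ?R = "PiE UNIV (\<lambda>j. {- (2 ^ (s j - q j)) ..< (2::int) ^ (s j - q j)})"
  have fin: "finite ?R" by (intro finite_PiE) auto
  have sub: "h ` ?K \<subseteq> ?R"
    using int_div_power_bounds[OF _ q(1)] by (auto simp: h_def)
  have inj: "inj_on h ?K"
  proof (rule inj_onI)
    fix k k' assume k: "k \<in> ?K" "k' \<in> ?K" "h k = h k'"
    have "\<bar>(k - k') $ j\<bar> < 2 ^ q j" for j
      using abs_diff_less_of_div_eq[of "k $ j" "2 ^ q j" "k' $ j"] fun_cong[OF k(3), of j]
      by (simp add: h_def)
    then have "max \<bar>(k - k') $ j\<bar> 1 \<le> 2 ^ q j" for j
      by (simp add: less_imp_le)
    then have "(\<Prod>j\<in>UNIV. max \<bar>(k - k') $ j\<bar> 1) \<le> (\<Prod>j\<in>UNIV. 2 ^ q j)"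
      by (intro prod_mono) auto
    also have "\<dots> = int (2 ^ l)" using q(2) by (simp add: power_sum[symmetric])
    also have "\<dots> \<le> int L" using l(1) by (simp only: of_nat_le_iff)
    finally show "k = k'" using diff k by (simp add: hyperbolic_cross_def)
  qed
  show "finite ?K" using inj_on_finite[OF inj sub fin] .
  have "card ?K \<le> card ?R" by (rule card_inj_on_le[OF inj sub fin])
  also have "\<dots> = (\<Prod>j\<in>UNIV. 2 * 2 ^ (s j - q j))"
    by (simp add: card_PiE nat_mult_distrib nat_power_eq)
  also have "\<dots> = 2 ^ CARD('n) * 2 ^ (\<Sum>j\<in>UNIV. s j - q j)"
    by (simp add: prod.distrib power_sum)
  also have "(\<Sum>j\<in>UNIV. s j - q j) = (\<Sum>j\<in>UNIV. s j) - l"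
    using q by (simp add: sum_subtractf_nat)
  finally show "card ?K \<le> 2 ^ CARD('n) * 2 ^ ((\<Sum>j\<in>UNIV. s j) - l)" .
qed

text \<open>The binary length. A nonzero \<open>k\<close> satisfies 2^(b-1) <= |k| < 2^b with b =
  \<open>bits k\<close>, while 0 forms a block of its own with \<open>bits 0 = 0\<close>.\<close>

definition bits :: "int \<Rightarrow> nat"
  where "bits k = (LEAST b. \<bar>k\<bar> < 2 ^ b)"

lemma abs_less_bits: "\<bar>k\<bar> < 2 ^ bits k"
proof -
  have "\<bar>k\<bar> < 2 ^ nat \<bar>k\<bar>"
    using of_nat_less_two_power[of "nat \<bar>k\<bar>"] by (metis abs_ge_zero int_nat_eq of_nat_less_iff of_nat_numeral of_nat_power)
  then show ?thesis unfolding bits_def by (rule LeastI)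
qed

lemma bits_0 [simp]: "bits 0 = 0"
  unfolding bits_def by (rule Least_eq_0) simp

lemma bits_le:
  assumes "k \<noteq> 0"
  shows "2 ^ bits k \<le> 2 * \<bar>k\<bar>"
proof -
  have "bits k \<noteq> 0" using abs_less_bits[of k] assms by (auto intro!: Nat.gr0I)
  then obtain b where b: "bits k = Suc b" using not0_implies_Suc by blast
  then have "\<not> \<bar>k\<bar> < 2 ^ b" unfolding bits_def by (metis lessI not_less_Least)
  then show ?thesis by (simp add: b)
qed

text \<open>With x = 2^s u, both sides are u x for x <= 1 and u / x otherwise. So the length of a
  block times the squared coefficient bound decays geometrically away from x = 1.\<close>

lemma dyadic_weight_eq:
  fixes u :: real
  assumes "0 < u"
  shows "2 ^ s * (min u (1 / 2 ^ s))\<^sup>2 = u * min (2 ^ s * u) (1 / (2 ^ s * u))"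
proof (cases "u \<le> 1 / 2 ^ s")
  case True
  then have "2 ^ s * u \<le> 1" by (simp add: field_simps)
  then have "2 ^ s * u \<le> 1 / (2 ^ s * u)"
    using assms mult_mono[of "2 ^ s * u" 1 "2 ^ s * u" 1] by (simp add: le_divide_eq)
  with True show ?thesis by (simp add: power2_eq_square)
next
  case False
  then have "1 < 2 ^ s * u" by (simp add: field_simps)
  then have "1 / (2 ^ s * u) < 2 ^ s * u"
    using less_1_mult[of "2 ^ s * u" "2 ^ s * u"] by (simp add: divide_less_eq)
  with False assms show ?thesis by (simp add: power2_eq_square min_def)
qed

text \<open>The separation property together with \<open>0 \<in> M\<close> keeps the points of
  \<open>F\<close> out of the hyperbolic cross. Reduce to squares, sum block by block, and apply the
  dyadic tail estimate.\<close>

lemma lattice_sum_le: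
  fixes M F :: "(int ^ 'n::finite) set" and u :: "'n \<Rightarrow> real"
  assumes diff: "\<And>k k'. k \<in> M \<Longrightarrow> k' \<in> M \<Longrightarrow> k - k' \<in> hyperbolic_cross L \<Longrightarrow> k = k'"
    and "0 \<in> M" and F: "finite F" "F \<subseteq> M - {0}"
    and u: "\<And>j. 0 < u j" and L: "1 \<le> L"
    and V: "real L * (\<Prod>j\<in>UNIV. u j) \<le> V" "exp 1 \<le> V" and r: "2 \<le> r"
  shows "(\<Sum>k\<in>F. (\<Prod>j\<in>UNIV. min (u j) (1 / 2 ^ bits (k $ j))) ^ r)
     \<le> 8 * exp 1 * 2 ^ CARD('n) * (1 / real L) ^ r * (4 * ln V) ^ (CARD('n) - 1)"
proof -
  define W where "W = (\<lambda>s. \<Prod>j\<in>UNIV. min (u j) (1 / 2 ^ s j))"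
  define b where "b = (\<lambda>(k::int^'n) j. bits (k $ j))"
  define N where "N = (\<lambda>s::'n \<Rightarrow> nat. \<Sum>j\<in>UNIV. s j)"
  define U where "U = (\<Prod>j\<in>UNIV. u j)"
  have U: "0 < U" using u by (simp add: U_def prod_pos)
  have W0: "0 \<le> W s" for s unfolding W_def using u by (intro prod_nonneg) (simp add: less_imp_le)
  \<comment> \<open>A block of volume at most \<open>L\<close> would put \<open>k = k - 0\<close>
    into the hyperbolic cross and force \<open>k = 0\<close>.\<close>
  have N: "L < 2 ^ N (b k)" if k: "k \<in> F" for k
  proof (rule ccontr)
    assume "\<not> ?thesis"
    then have "2 ^ N (b k) \<le> L" by simp
    moreover have "(\<Prod>j\<in>UNIV. max \<bar>k $ j\<bar> 1) \<le> (\<Prod>j\<in>UNIV. 2 ^ b k j)"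
      using abs_less_bits by (intro prod_mono) (auto simp: b_def less_imp_le)
    moreover have "(\<Prod>j\<in>UNIV. 2 ^ b k j) = int (2 ^ N (b k))"
      by (simp add: N_def power_sum)
    ultimately have "(\<Prod>j\<in>UNIV. max \<bar>k $ j\<bar> 1) \<le> int L"
      by (metis of_nat_le_iff order_trans)
    then have "k - 0 \<in> hyperbolic_cross L" by (simp add: hyperbolic_cross_def)
    with diff[of k 0] k F \<open>0 \<in> M\<close> show False by auto
  qed
  \<comment> \<open>The largest power of 2 not exceeding \<open>L\<close>; replacing
    \<open>2 ^ l\<close> by \<open>L\<close> later costs a factor 2.\<close>
  obtain l where l: "2 ^ l \<le> L" "L < 2 ^ (l + 1)"
    using ex_power_ivl1[of 2 L] L by auto
  have l_less: "l \<le> N (b k)" if "k \<in> F" for k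
    using le_less_trans[OF l(1) N[OF that]] by (simp add: power_strict_increasing_iff)
  \<comment> \<open>Since \<open>W (b k) \<le> 1 / 2 ^ N (b k) \<le> 1 / L\<close>, all factors
    beyond the second come out with constant 1.\<close>
  have "(\<Sum>k\<in>F. W (b k) ^ r) \<le> (\<Sum>k\<in>F. (1 / real L) ^ (r - 2) * (W (b k))\<^sup>2)"
  proof (rule sum_mono)
    fix k assume k: "k \<in> F"
    have "W (b k) \<le> (\<Prod>j\<in>UNIV. 1 / 2 ^ b k j)"
      unfolding W_def using u by (intro prod_mono) (simp add: less_imp_le)
    also have "\<dots> = 1 / 2 ^ N (b k)"
      by (simp add: N_def power_sum prod_dividef)
    also have "\<dots> \<le> 1 / real L"
    proof -
      have "real L \<le> real (2 ^ N (b k))" using N[OF k] by (simp only: of_nat_le_iff less_imp_le)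
      then show ?thesis using L by (intro divide_left_mono) auto
    qed
    finally have "W (b k) ^ (r - 2) \<le> (1 / real L) ^ (r - 2)"
      using W0 by (intro power_mono)
    then have "W (b k) ^ (r - 2) * (W (b k))\<^sup>2 \<le> (1 / real L) ^ (r - 2) * (W (b k))\<^sup>2"
      by (intro mult_right_mono) auto
    moreover have "W (b k) ^ (r - 2) * (W (b k))\<^sup>2 = W (b k) ^ r"
      using r by (simp only: power_add[symmetric] le_add_diff_inverse2)
    ultimately show "W (b k) ^ r \<le> (1 / real L) ^ (r - 2) * (W (b k))\<^sup>2"
      by simp
  qed
  also have "\<dots> = (1 / real L) ^ (r - 2) * (\<Sum>k\<in>F. (W (b k))\<^sup>2)"
    by (simp add: sum_distrib_left)
  \<comment> \<open>Group the points by block: the weight is constant on each, so only the number of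
    points matters.\<close>
  also have "(\<Sum>k\<in>F. (W (b k))\<^sup>2) = (\<Sum>s\<in>b ` F. \<Sum>k | k \<in> F \<and> b k = s. (W (b k))\<^sup>2)"
    by (rule sum.image_gen[OF F(1)])
  also have "\<dots> = (\<Sum>s\<in>b ` F. real (card {k \<in> F. b k = s}) * (W s)\<^sup>2)"
    by (intro sum.cong) auto
  also have "\<dots> \<le> (\<Sum>s\<in>b ` F. 2 ^ CARD('n) * 2 * U / L *
      (\<Prod>j\<in>UNIV. min (2 ^ s j * u j) (1 / (2 ^ s j * u j))))"
  proof (rule sum_mono)
    fix s assume s: "s \<in> b ` F"
    then have ls: "l \<le> N s" using l_less by auto
    have box: "finite {k \<in> M. \<forall>j. \<bar>k $ j\<bar> < 2 ^ s j}"
      "card {k \<in> M. \<forall>j. \<bar>k $ j\<bar> < 2 ^ s j} \<le> 2 ^ CARD('n) * 2 ^ (N s - l)"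
      using card_lattice_dyadic_box_le[OF diff l(1) ls[unfolded N_def]] by (simp_all add: N_def)
    have "card {k \<in> F. b k = s} \<le> card {k \<in> M. \<forall>j. \<bar>k $ j\<bar> < 2 ^ s j}"
      using F abs_less_bits by (intro card_mono box(1)) (auto simp: b_def)
    also have "\<dots> \<le> 2 ^ CARD('n) * 2 ^ (N s - l)" by (rule box(2))
    finally have "real (card {k \<in> F. b k = s}) \<le> real (2 ^ CARD('n) * 2 ^ (N s - l))"
      by (simp only: of_nat_le_iff)
    also have "\<dots> = 2 ^ CARD('n) * 2 ^ (N s - l)" by simp
    also have "\<dots> = 2 ^ CARD('n) * (2 ^ N s / 2 ^ l)"
      using ls by (simp add: power_diff)
    also have "\<dots> \<le> 2 ^ CARD('n) * (2 * 2 ^ N s / real L)"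
    proof (rule mult_left_mono)
      have "real L \<le> real (2 ^ (l + 1))" using l(2) by (simp only: of_nat_le_iff less_imp_le)
      then show "2 ^ N s / 2 ^ l \<le> 2 * 2 ^ N s / real L"
        using L by (simp add: field_simps)
    qed simp
    finally have "real (card {k \<in> F. b k = s}) * (W s)\<^sup>2
        \<le> 2 ^ CARD('n) * (2 * 2 ^ N s / real L) * (W s)\<^sup>2"
      by (rule mult_right_mono) simp
    also have "\<dots> = 2 ^ CARD('n) * 2 / real L * (2 ^ N s * (W s)\<^sup>2)" by simp
    also have "2 ^ N s * (W s)\<^sup>2 = (\<Prod>j\<in>UNIV. 2 ^ s j * (min (u j) (1 / 2 ^ s j))\<^sup>2)"
      by (simp add: N_def W_def power_sum prod.distrib prod_power_distrib)
    also have "\<dots> = U * (\<Prod>j\<in>UNIV. min (2 ^ s j * u j) (1 / (2 ^ s j * u j)))"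
      unfolding dyadic_weight_eq[OF u] U_def by (simp add: prod.distrib)
    finally show "real (card {k \<in> F. b k = s}) * (W s)\<^sup>2 \<le> 2 ^ CARD('n) * 2 * U / L *
      (\<Prod>j\<in>UNIV. min (2 ^ s j * u j) (1 / (2 ^ s j * u j)))" by (simp add: mult_ac)
  qed
  also have "\<dots> = 2 ^ CARD('n) * 2 * U / L *
      (\<Sum>s\<in>b ` F. \<Prod>j\<in>UNIV. min (2 ^ s j * u j) (1 / (2 ^ s j * u j)))"
    by (simp add: sum_distrib_left)
  \<comment> \<open>An occupied block has volume above \<open>L\<close>, so the tail estimate
    applies with \<open>A = L * U\<close>; its factor 1/U cancels the \<open>U\<close> in
    front.\<close>
  also have "\<dots> \<le> 2 ^ CARD('n) * 2 * U / L * (4 * exp 1 / (L * U) * (4 * ln V) ^ (CARD('n) - 1))"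
  proof (intro mult_left_mono sum_dyadic_box_tail_le)
    fix s assume "s \<in> b ` F"
    then have "L < 2 ^ N s" using N by auto
    then have "real L < real (2 ^ N s)" by (simp only: of_nat_less_iff)
    then show "real L * U \<le> (\<Prod>j\<in>UNIV. 2 ^ s j * u j)"
      using U by (simp add: prod.distrib N_def power_sum[symmetric] U_def[symmetric])
  qed (use F U u L V in \<open>auto simp: U_def\<close>)
  also have "\<dots> = 8 * exp 1 * 2 ^ CARD('n) * (1 / real L)\<^sup>2 * (4 * ln V) ^ (CARD('n) - 1)"
    using U L by (simp add: power2_eq_square field_simps)
  finally have "(\<Sum>k\<in>F. W (b k) ^ r) \<le> (1 / real L) ^ (r - 2) *
      (8 * exp 1 * 2 ^ CARD('n) * (1 / real L)\<^sup>2 * (4 * ln V) ^ (CARD('n) - 1))"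
    by (simp add: mult_left_mono)
  also have "\<dots> = 8 * exp 1 * 2 ^ CARD('n) * ((1 / real L) ^ (r - 2) * (1 / real L)\<^sup>2) * (4 * ln V) ^ (CARD('n) - 1)"
    by (simp only: mult_ac)
  also have "(1 / real L) ^ (r - 2) * (1 / real L)\<^sup>2 = (1 / real L) ^ r"
    using r by (simp only: power_add[symmetric] le_add_diff_inverse2)
  finally show ?thesis by (simp add: W_def b_def)
qed

subsection \<open>Characters and Korobov points\<close>

text \<open>The Fourier coefficient of the periodized hat function. The separate value at 0 is the
  limit of the quotient.\<close>

definition hat_coeff :: "nat \<Rightarrow> real \<Rightarrow> int \<Rightarrow> real"
  where "hat_coeff r u k = (if k = 0 then u ^ r else (sin (pi * of_int k * u) / (pi * of_int k)) ^ r)"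

text \<open>The bound \<open>u\<close> comes from |sin y| <= |y|. The dyadic bound comes from |sin
  y| <= 1 and pi >= 2, which absorbs the 2 in \<open>bits_le\<close>. At \<open>k = 0\<close> the
  assumption \<open>u \<le> 1\<close> makes the minimum equal to \<open>u\<close>.\<close>

lemma abs_hat_coeff_le:
  assumes "0 < u" "u \<le> 1"
  shows "\<bar>hat_coeff r u k\<bar> \<le> min u (1 / 2 ^ bits k) ^ r"
proof (cases "k = 0")
  case True
  then show ?thesis using assms by (simp add: hat_coeff_def)
next
  case False
  define q where "q = sin (pi * of_int k * u) / (pi * of_int k)"
  have k: "0 < \<bar>of_int k :: real\<bar>" using False by simp
  have q: "\<bar>q\<bar> = \<bar>sin (pi * of_int k * u)\<bar> / (pi * \<bar>of_int k\<bar>)"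
    by (simp add: q_def abs_mult)
  have "\<bar>q\<bar> \<le> \<bar>pi * of_int k * u\<bar> / (pi * \<bar>of_int k\<bar>)"
    unfolding q by (rule divide_right_mono[OF abs_sin_x_le_abs_x]) simp
  also have "\<dots> = u" using k assms by (simp add: abs_mult)
  finally have 1: "\<bar>q\<bar> \<le> u" .
  have "real_of_int (2 ^ bits k) \<le> real_of_int (2 * \<bar>k\<bar>)"
    using bits_le[OF False] by (simp only: of_int_le_iff)
  then have b: "2 ^ bits k \<le> 2 * \<bar>real_of_int k\<bar>" by simp
  have "\<bar>q\<bar> \<le> 1 / (2 * \<bar>of_int k\<bar>)"
    unfolding q using k pi_ge_two by (intro frac_le mult_right_mono abs_sin_le_one) auto
  also have "\<dots> \<le> 1 / 2 ^ bits k" using b by (intro frac_le) auto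
  finally have 2: "\<bar>q\<bar> \<le> 1 / 2 ^ bits k" .
  have "\<bar>q ^ r\<bar> \<le> min u (1 / 2 ^ bits k) ^ r"
    unfolding power_abs using 1 2 by (intro power_mono) auto
  then show ?thesis using False by (simp add: hat_coeff_def q_def)
qed

lemma hat_coeff_minus: "hat_coeff r u (- k) = hat_coeff r u k"
  by (simp add: hat_coeff_def)

abbreviation circle_exp :: "real \<Rightarrow> complex"
  where "circle_exp t \<equiv> exp (\<i> * of_real (2 * pi * t))"

text \<open>Symmetric partial sums keep the later manipulations finite; the limit in
  \<open>N\<close> is taken only at the end.\<close>

lemma hat_partial_sum_complex:
  "complex_of_real (u ^ r + (\<Sum>n<N. hat_term r u x n))
     = (\<Sum>k\<in>{- int N..int N}. of_real (hat_coeff r u k) * circle_exp (of_int k * x))"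
proof (induction N)
  case 0
  then show ?case by (simp add: hat_coeff_def)
next
  case (Suc N)
  let ?f = "\<lambda>k. of_real (hat_coeff r u k) * circle_exp (of_int k * x)"
  let ?k = "int (Suc N)"
  have "{- ?k..?k} = insert ?k (insert (- ?k) {- int N..int N})" by auto
  then have "(\<Sum>k\<in>{- ?k..?k}. ?f k) = ?f ?k + ?f (- ?k) + (\<Sum>k\<in>{- int N..int N}. ?f k)"
    by simp
  also have "?f ?k + ?f (- ?k) = of_real (hat_coeff r u ?k) * (circle_exp (of_int ?k * x) + circle_exp (of_int (- ?k) * x))"
    by (simp only: hat_coeff_minus distrib_left)
  also have "circle_exp (of_int ?k * x) + circle_exp (of_int (- ?k) * x) = of_real (2 * cos (2 * pi * real (Suc N) * x))"
    by (simp add: exp_eq_polar complex_eq_iff cis.code mult_ac del: of_nat_Suc)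
  also have "of_real (hat_coeff r u ?k) * complex_of_real (2 * cos (2 * pi * real (Suc N) * x))
      = complex_of_real (hat_term r u x N)"
    by (simp add: hat_coeff_def hat_term_def del: of_nat_Suc)
  finally show ?case using Suc.IH by simp
qed

lemma circle_exp_inner:
  "circle_exp (int_vec k \<bullet> x) = (\<Prod>j\<in>UNIV. circle_exp (of_int (k $ j) * x $ j))"
  by (simp add: inner_vec_def int_vec_def sum_distrib_left exp_sum)

lemma circle_exp_of_int_add: "circle_exp (of_int n + t) = circle_exp t"
proof -
  have "circle_exp (of_int n) = 1" by (auto simp: exp_eq_1 intro!: exI[of _ n])
  then show ?thesis by (simp add: distrib_left exp_add)
qed

text \<open>Divisibility of this number by \<open>m\<close> is membership in the dual lattice of the
  Korobov points.\<close>

definition char_index :: "int ^ 'n \<Rightarrow> int ^ 'n::finite \<Rightarrow> int"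
  where "char_index a k = (\<Sum>j\<in>UNIV. a $ j * k $ j)"

text \<open>The integer parts removed by \<open>frac\<close> shift the phase by an integer only, so
  the character at point \<open>\<mu>\<close> is the \<open>\<mu>\<close>-th power of one root of
  unity.\<close>

lemma circle_exp_korobov_point:
  "circle_exp (int_vec k \<bullet> korobov_point m a \<mu>) = circle_exp (of_int (char_index a k) / real m) ^ \<mu>"
proof -
  have "int_vec k \<bullet> korobov_point m a \<mu>
     = (\<Sum>j\<in>UNIV. of_int (k $ j) * (real \<mu> * of_int (a $ j) / real m))
       + of_int (- (\<Sum>j\<in>UNIV. k $ j * \<lfloor>real \<mu> * of_int (a $ j) / real m\<rfloor>))"
    by (simp add: inner_vec_def int_vec_def korobov_point_def frac_def right_diff_distrib sum_subtractf)
  also have "(\<Sum>j\<in>UNIV. of_int (k $ j) * (real \<mu> * of_int (a $ j) / real m))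
     = real \<mu> * (of_int (char_index a k) / real m)"
    by (simp add: char_index_def sum_distrib_left sum_divide_distrib mult_ac)
  finally have "circle_exp (int_vec k \<bullet> korobov_point m a \<mu>)
      = circle_exp (real \<mu> * (of_int (char_index a k) / real m))"
    by (simp only: add.commute[of _ "of_int _"] circle_exp_of_int_add)
  also have "\<dots> = circle_exp (of_int (char_index a k) / real m) ^ \<mu>"
    by (simp add: exp_of_nat_mult[symmetric] mult_ac)
  finally show ?thesis .
qed

text \<open>A geometric sum over the powers of an \<open>m\<close>-th root of unity
  \<open>\<omega>\<close>: it vanishes unless \<open>\<omega> = 1\<close>, which is the divisibility
  condition.\<close>

lemma korobov_character_average:
  assumes "1 \<le> m"
  shows "(\<Sum>\<mu>=1..m. circle_exp (int_vec k \<bullet> korobov_point m a \<mu>)) / of_nat m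
    = (if int m dvd char_index a k then 1 else 0)"
proof -
  define \<omega> where "\<omega> = circle_exp (of_int (char_index a k) / real m)"
  have "\<omega> ^ m = circle_exp (of_int (char_index a k))"
    using assms by (simp add: \<omega>_def exp_of_nat_mult[symmetric])
  also have "\<dots> = 1" using circle_exp_of_int_add[of "char_index a k" 0] by simp
  finally have \<omega>m: "\<omega> ^ m = 1" .
  have \<omega>1: "\<omega> = 1 \<longleftrightarrow> int m dvd char_index a k"
  proof -
    have "\<omega> = 1 \<longleftrightarrow> (\<exists>n::int. 2 * pi * (of_int (char_index a k) / real m) = of_int (2 * n) * pi)"
      by (simp add: \<omega>_def exp_eq_1)
    also have "\<dots> \<longleftrightarrow> (\<exists>n::int. real_of_int (char_index a k) = real_of_int (int m * n))"
      using assms by (simp add: field_simps)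
    also have "\<dots> \<longleftrightarrow> int m dvd char_index a k"
      unfolding of_int_eq_iff dvd_def ..
    finally show ?thesis .
  qed
  have "(\<Sum>\<mu>=1..m. circle_exp (int_vec k \<bullet> korobov_point m a \<mu>)) = (\<Sum>\<mu>=1..m. \<omega> ^ \<mu>)"
    by (simp only: circle_exp_korobov_point \<omega>_def)
  also have "\<dots> = \<omega> * (\<Sum>\<mu><m. \<omega> ^ \<mu>)"
    by (simp add: sum_distrib_left sum.atLeast1_atMost_eq)
  finally show ?thesis
    using assms \<omega>m \<omega>1 by (cases "\<omega> = 1") (simp_all add: geometric_sum)
qed

section \<open>Product integrals over the unit cube and exactness\<close>

lemma integral_prod_vec:
  fixes g :: "'n::finite \<Rightarrow> real \<Rightarrow> 'b::{real_normed_field,banach,second_countable_topology}"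
  assumes "\<And>j. integrable lborel (g j)"
  shows "(LINT x|(lborel :: (real ^ 'n) measure). (\<Prod>j\<in>UNIV. g j (x $ j))) = (\<Prod>j\<in>UNIV. LINT t|lborel. g j t)"
proof -
  interpret product_sigma_finite "\<lambda>_::real^'n. lborel :: real measure"
    by standard
  have inj: "inj (\<lambda>j. axis j 1 :: real ^ 'n)" by (auto simp: inj_def axis_eq_axis)
  have Basis: "Basis = range (\<lambda>j. axis j 1 :: real ^ 'n)"
    by (auto simp: Basis_vec_def)
  \<comment> \<open>The product measure is indexed by basis vectors, not by coordinates; inverting
    \<open>axis\<close> recovers the coordinate so that Fubini for product measures applies.\<close>
  define G where "G = (\<lambda>b::real^'n. g (inv (\<lambda>j. axis j 1) b))"
  have G: "G (axis j 1) = g j" for j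
    by (simp add: G_def inv_f_f[OF inj])
  have [measurable]: "g j \<in> borel_measurable borel" for j
    using borel_measurable_integrable[OF assms] by simp
  have "(LINT x|(lborel :: (real ^ 'n) measure). (\<Prod>j\<in>UNIV. g j (x $ j)))
     = (LINT f|(\<Pi>\<^sub>M b\<in>(Basis :: (real^'n) set). lborel). (\<Prod>j\<in>UNIV. g j ((\<Sum>b\<in>Basis. f b *\<^sub>R b) $ j)))"
    unfolding lborel_eq[where 'a = "real ^ 'n"]
    by (rule integral_distr) measurable
  also have "\<dots> = (LINT f|(\<Pi>\<^sub>M b\<in>(Basis :: (real^'n) set). lborel). (\<Prod>b\<in>Basis. G b (f b)))"
  proof (intro Bochner_Integration.integral_cong refl)
    fix f :: "real ^ 'n \<Rightarrow> real"
    have "(\<Sum>b\<in>Basis. f b *\<^sub>R b) $ j = f (axis j 1)" for j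
      using inner_sum_left_Basis[of "axis j 1 :: real^'n" f] by (simp add: inner_axis)
    then show "(\<Prod>j\<in>UNIV. g j ((\<Sum>b\<in>Basis. f b *\<^sub>R b) $ j)) = (\<Prod>b\<in>Basis. G b (f b))"
      unfolding Basis by (simp add: prod.reindex[OF inj] G)
  qed
  also have "\<dots> = (\<Prod>b\<in>Basis. LINT t|lborel. G b t)"
    by (rule product_integral_prod) (auto simp: G_def assms)
  also have "\<dots> = (\<Prod>j\<in>UNIV. LINT t|lborel. g j t)"
    unfolding Basis by (simp add: prod.reindex[OF inj] G)
  finally show ?thesis .
qed

text \<open>The cube has half-open sides. Closing them changes only a null set and makes the
  fundamental theorem of calculus applicable to each factor.\<close>

lemma integral_unit_cube_prod:
  fixes f :: "'n::finite \<Rightarrow> real \<Rightarrow> 'b::{real_normed_field,banach,second_countable_topology}"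
  assumes "\<And>j. continuous_on UNIV (f j)"
  shows "(LINT x:(unit_cube :: (real ^ 'n) set)|lborel. (\<Prod>j\<in>UNIV. f j (x $ j)))
    = (\<Prod>j\<in>UNIV. LINT t|lborel. indicator {0..1} t *\<^sub>R f j t)"
proof -
  have [measurable]: "f j \<in> borel_measurable borel" for j
    using assms by (rule borel_measurable_continuous_onI)
  have c: "integrable lborel (\<lambda>t. indicator {0..1} t *\<^sub>R f j t)" for j
    by (intro borel_integrable_compact continuous_on_subset[OF assms]) auto
  have ae: "AE t in lborel. indicator {0..<1} t *\<^sub>R f j t = indicator {0..1} t *\<^sub>R f j t" for j
    using AE_lborel_singleton[of "1::real"] by eventually_elim (auto simp: indicator_def)
  have i: "integrable lborel (\<lambda>t. indicator {0..<1} t *\<^sub>R f j t)" for j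
    using c ae by (subst integrable_cong_AE[where g = "\<lambda>t. indicator {0..1} t *\<^sub>R f j t"]) auto
  have "(LINT x:(unit_cube :: (real ^ 'n) set)|lborel. (\<Prod>j\<in>UNIV. f j (x $ j)))
     = (LINT x|(lborel :: (real ^ 'n) measure). (\<Prod>j\<in>UNIV. indicator {0..<1} (x $ j) *\<^sub>R f j (x $ j)))"
    unfolding set_lebesgue_integral_def
  proof (intro Bochner_Integration.integral_cong refl)
    fix x :: "real ^ 'n"
    have "indicator unit_cube x = (\<Prod>j\<in>UNIV. indicator {0..<1} (x $ j) :: real)"
      by (auto simp: unit_cube_def indicator_def)
    then show "indicator unit_cube x *\<^sub>R (\<Prod>j\<in>UNIV. f j (x $ j))
       = (\<Prod>j\<in>UNIV. indicator {0..<1} (x $ j) *\<^sub>R f j (x $ j))"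
      by (simp add: scaleR_conv_of_real prod.distrib)
  qed
  also have "\<dots> = (\<Prod>j\<in>UNIV. LINT t|lborel. indicator {0..<1} t *\<^sub>R f j t)"
    by (rule integral_prod_vec[OF i])
  also have "\<dots> = (\<Prod>j\<in>UNIV. LINT t|lborel. indicator {0..1} t *\<^sub>R f j t)"
    by (intro prod.cong refl Bochner_Integration.integral_cong_AE ae) auto
  finally show ?thesis .
qed

lemma integral_circle_exp:
  assumes "k \<noteq> 0"
  shows "(LINT t|lborel. indicator {0..1} t *\<^sub>R circle_exp (of_int k * t)) = 0"
proof -
  let ?F = "\<lambda>t. circle_exp (of_int k * t) / (2 * of_real pi * \<i> * of_int k)"
  have "(LINT t|lborel. indicator {0..1} t *\<^sub>R circle_exp (of_int k * t)) = ?F 1 - ?F 0"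
  proof (rule integral_FTC_atLeastAtMost[where F = ?F])
    fix t :: real
    let ?G = "\<lambda>z. exp (2 * of_real pi * \<i> * of_int k * z) / (2 * of_real pi * \<i> * of_int k)"
    have "(?G has_field_derivative exp (2 * of_real pi * \<i> * of_int k * of_real t)) (at (of_real t))"
      using assms by (auto intro!: derivative_eq_intros)
    from has_vector_derivative_real_field[OF this]
    show "(?F has_vector_derivative circle_exp (of_int k * t)) (at t within {0..1})"
      by (simp add: mult_ac)
  qed (auto intro!: continuous_intros)
  also have "\<dots> = 0" using circle_exp_of_int_add[of k 0] by simp
  finally show ?thesis .
qed

lemma integral_unit_cube_circle_exp:
  fixes k :: "int ^ 'n::finite"
  assumes "k \<noteq> 0"
  shows "(LINT x:unit_cube|lborel. circle_exp (int_vec k \<bullet> x)) = 0"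
proof -
  obtain j where j: "k $ j \<noteq> 0" using assms by (auto simp: vec_eq_iff)
  have "(LINT x:unit_cube|lborel. circle_exp (int_vec k \<bullet> x))
     = (\<Prod>j\<in>UNIV. LINT t|lborel. indicator {0..1} t *\<^sub>R circle_exp (of_int (k $ j) * t))"
    unfolding circle_exp_inner by (rule integral_unit_cube_prod) (intro continuous_intros)
  also have "\<dots> = 0" using integral_circle_exp[OF j] by (intro prod_zero) auto
  finally show ?thesis .
qed

text \<open>A nonzero \<open>k\<close> of this kind would give a character in
  \<open>trig_polys L\<close> whose integral is 0 but whose average over the Korobov points is
  1.\<close>

lemma korobov_exact_lattice:
  fixes a k :: "int ^ 'n::finite"
  assumes "korobov_exact m a L" "1 \<le> m" "k \<in> hyperbolic_cross L" "int m dvd char_index a k"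
  shows "k = 0"
proof (rule ccontr)
  assume "k \<noteq> 0"
  let ?f = "\<lambda>x. circle_exp (int_vec k \<bullet> x)"
  have "?f = (\<lambda>x. \<Sum>h\<in>hyperbolic_cross L. (if h = k then 1 else 0) * circle_exp (int_vec h \<bullet> x))"
    using assms(3) finite_hyperbolic_cross[of L, where 'n = 'n]
    by (simp add: fun_eq_iff if_distrib[of "\<lambda>c. c * _"] sum.delta cong: if_cong)
  then have "?f \<in> trig_polys L"
    unfolding trig_polys_def by (intro CollectI exI[of _ "\<lambda>h. if h = k then 1 else 0"])
  then have "korobov_cubature m a ?f = 0"
    using assms(1) integral_unit_cube_circle_exp[OF \<open>k \<noteq> 0\<close>] by (simp add: korobov_exact_def)
  then show False
    using korobov_character_average[OF assms(2), of k a] assms(4) by (simp add: korobov_cubature_def)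
qed

subsection \<open>The discrepancy bound\<close>

lemma hat_series_LIMSEQ:
  assumes "2 \<le> r"
  shows "(\<lambda>N. u ^ r + (\<Sum>n<N. hat_term r u x n)) \<longlonglongrightarrow> hat_series r u x"
  unfolding hat_series_def
  by (intro tendsto_add tendsto_const summable_LIMSEQ[OF summable_rabs_cancel[OF summable_hat_term[OF assms]]])

text \<open>The sides \<open>r * u $ j\<close> are at most 1, so only one integer shift can meet the
  support and the infinite sum has one relevant term. There the hat equals its series, and
  periodicity removes the shift.\<close>

lemma periodic_box_hat_eq:
  fixes w u x :: "real ^ 'n::finite"
  assumes "2 \<le> r" and u: "\<And>j. 0 < u $ j" "\<And>j. real r * u $ j \<le> 1"
  shows "periodic_box_hat r w u x = (\<Prod>j\<in>UNIV. hat_series r (u $ j) (x $ j - w $ j))"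
proof -
  \<comment> \<open>Rounding to the nearest integer: every coordinate of the shifted argument then
    lies in [-1/2, 1/2].\<close>
  define n0 :: "int ^ 'n" where "n0 = (\<chi> j. - \<lfloor>x $ j - w $ j + 1 / 2\<rfloor>)"
  define t where "t = (\<lambda>(n :: int ^ 'n) j. of_int (n $ j) + x $ j - w $ j)"
  have t0: "\<bar>t n0 j\<bar> \<le> 1 / 2" for j
  proof -
    have "t n0 j = x $ j - w $ j - of_int \<lfloor>x $ j - w $ j + 1 / 2\<rfloor>" by (simp add: t_def n0_def)
    then show ?thesis using floor_correct[of "x $ j - w $ j + 1 / 2"] by linarith
  qed
  have bh: "box_hat r w u (int_vec n + x) = (\<Prod>j\<in>UNIV. hat r (u $ j) (t n j))" for n
    by (simp add: box_hat_def int_vec_def t_def)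
  have "box_hat r w u (int_vec n + x) = 0" if n: "n \<noteq> n0" for n
  proof -
    obtain j where "n $ j \<noteq> n0 $ j" using n by (auto simp: vec_eq_iff)
    then have "1 \<le> \<bar>n $ j - n0 $ j\<bar>" by linarith
    then have "1 \<le> \<bar>real_of_int (n $ j) - real_of_int (n0 $ j)\<bar>" by linarith
    moreover have "t n j - t n0 j = of_int (n $ j) - of_int (n0 $ j)" by (simp add: t_def)
    ultimately have "1 / 2 \<le> \<bar>t n j\<bar>" using t0[of j] by linarith
    then have "hat r (u $ j) (t n j) = 0" using u(2)[of j] by (intro hat_eq_0 assms(1) u(1)) linarith
    then show ?thesis unfolding bh by (intro prod_zero) auto
  qed
  then have "periodic_box_hat r w u x = infsum (\<lambda>n. box_hat r w u (int_vec n + x)) {n0}"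
    unfolding periodic_box_hat_def by (intro infsum_cong_neutral) auto
  also have "\<dots> = (\<Prod>j\<in>UNIV. hat r (u $ j) (t n0 j))" by (simp add: bh)
  also have "\<dots> = (\<Prod>j\<in>UNIV. hat_series r (u $ j) (t n0 j))"
  proof (intro prod.cong refl hat_eq_series assms(1) u(1))
    fix j show "\<bar>t n0 j\<bar> \<le> 1 - real r * u $ j / 2" using t0[of j] u(2)[of j] by linarith
  qed
  also have "\<dots> = (\<Prod>j\<in>UNIV. hat_series r (u $ j) (x $ j - w $ j))"
  proof (intro prod.cong refl)
    fix j
    have "t n0 j = (x $ j - w $ j) + of_int (n0 $ j)" by (simp add: t_def)
    then show "hat_series r (u $ j) (t n0 j) = hat_series r (u $ j) (x $ j - w $ j)"
      by (simp only: hat_series_periodic)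
  qed
  finally show ?thesis .
qed

lemma admissible_box_bounds:
  fixes w u :: "real ^ 'n::finite"
  assumes "(w, u) \<in> admissible_boxes r v" "1 \<le> r"
  shows "0 < u $ j" "real r * u $ j \<le> 1" "(\<Prod>j\<in>UNIV. u $ j) \<le> v"
proof -
  have u: "\<And>j. 0 < u $ j" and sub: "hat_box r w u \<subseteq> unit_cube"
    and v: "measure lborel (hat_box r w u) = v"
    using assms by (auto simp: admissible_boxes_def)
  have ru: "0 < real r * u $ j" for j using u[of j] assms(2) by simp
  show "0 < u $ j" by (rule u)
  show "real r * u $ j \<le> 1"
  proof (rule ccontr)
    assume c: "\<not> ?thesis"
    \<comment> \<open>Start at the lower corner of the box and move by \<open>t\<close> along
      coordinate \<open>j\<close>. If the side exceeded 1, then \<open>y 0\<close> and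
      \<open>y 1\<close> would both lie in the half-open cube.\<close>
    define y :: "real \<Rightarrow> real ^ 'n"
      where "y t = (\<chi> i. w $ i - real r * u $ i / 2 + (if i = j then t else 0))" for t
    have y: "y t $ j \<in> {0..<1}" if t: "0 \<le> t" "t < real r * u $ j" for t
    proof -
      have "w $ i - real r * u $ i / 2 \<le> y t $ i \<and> y t $ i < w $ i + real r * u $ i / 2" for i
        using t ru[of i] by (cases "i = j") (simp_all add: y_def)
      then have "y t \<in> hat_box r w u" unfolding hat_box_def by blast
      with sub show ?thesis unfolding unit_cube_def by auto
    qed
    show False using y[of 0] y[of 1] c ru[of j] by (simp add: y_def)
  qed
  define a b where "a = (\<chi> i. w $ i - real r * u $ i / 2)" and "b = (\<chi> i. w $ i + real r * u $ i / 2)"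
  have hat_box: "hat_box r w u = {x. \<forall>j. a $ j \<le> x $ j \<and> x $ j < b $ j}"
    by (simp add: hat_box_def a_def b_def)
  \<comment> \<open>The open box gives the lower bound for the volume; the closed one ensures that
    the volume is finite.\<close>
  have box1: "box a b \<subseteq> hat_box r w u" and box2: "hat_box r w u \<subseteq> cbox a b"
    by (auto simp: hat_box mem_box_cart less_imp_le)
  have meas: "hat_box r w u \<in> sets lborel"
    unfolding hat_box by measurable
  have "(\<Prod>j\<in>UNIV. u $ j) \<le> (\<Prod>j\<in>UNIV. b $ j - a $ j)"
  proof (intro prod_mono conjI)
    fix j
    have "1 * u $ j \<le> real r * u $ j" using u[of j] assms(2) by (intro mult_right_mono) auto
    then show "u $ j \<le> b $ j - a $ j" by (simp add: a_def b_def)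
  qed (use u in \<open>simp add: less_imp_le\<close>)
  also have "\<dots> = measure lborel (box a b)"
  proof -
    have "a \<bullet> i \<le> b \<bullet> i" if "i \<in> Basis" for i
      using that ru by (auto simp: Basis_vec_def inner_axis a_def b_def less_imp_le)
    then have "measure lborel (box a b) = (\<Prod>i\<in>Basis. (b - a) \<bullet> i)"
      by (simp add: inner_diff_left)
    also have "Basis = range (\<lambda>j. axis j 1 :: real ^ 'n)" by (auto simp: Basis_vec_def)
    finally show ?thesis by (simp add: prod.reindex inj_def axis_eq_axis inner_axis)
  qed
  also have "\<dots> \<le> measure lborel (hat_box r w u)"
  proof (rule measure_mono_fmeasurable[OF box1])
    show "hat_box r w u \<in> fmeasurable lborel"
      by (rule fmeasurableI2[OF fmeasurable_cbox box2 meas])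
  qed simp
  finally show "(\<Prod>j\<in>UNIV. u $ j) \<le> v" using v by simp
qed

lemma prod_sum_vec:
  fixes f :: "'n::finite \<Rightarrow> 'b \<Rightarrow> 'c::comm_semiring_1"
  assumes "finite I"
  shows "finite {k :: 'b ^ 'n. \<forall>j. k $ j \<in> I}"
    and "(\<Prod>j\<in>UNIV. \<Sum>i\<in>I. f j i) = (\<Sum>k | \<forall>j. k $ j \<in> I. \<Prod>j\<in>UNIV. f j (k $ j))"
proof -
  have bij: "bij_betw vec_lambda (PiE UNIV (\<lambda>_. I)) {k :: 'b ^ 'n. \<forall>j. k $ j \<in> I}"
    by (rule bij_betwI[where g = vec_nth]) auto
  have "finite (PiE (UNIV :: 'n set) (\<lambda>_. I))" using assms by (intro finite_PiE) auto
  then show "finite {k :: 'b ^ 'n. \<forall>j. k $ j \<in> I}"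
    using bij_betw_finite[OF bij] by simp
  show "(\<Prod>j\<in>UNIV. \<Sum>i\<in>I. f j i) = (\<Sum>k | \<forall>j. k $ j \<in> I. \<Prod>j\<in>UNIV. f j (k $ j))"
    using assms sum.reindex_bij_betw[OF bij, of "\<lambda>k. \<Prod>j\<in>UNIV. f j (k $ j)"]
    by (simp add: prod_sum_PiE)
qed

text \<open>Averaging the partial sums over the Korobov points leaves only the frequencies in the dual
  lattice; the frequency \<open>0\<close> reproduces the integral.\<close>

lemma korobov_partial_sum_error_le:
  fixes a :: "int ^ 'n::finite" and u t :: "real ^ 'n"
  assumes ex: "korobov_exact m a L" and m: "1 \<le> m" and L: "1 \<le> L" and r: "2 \<le> r"
    and u: "\<And>j. 0 < u $ j" "\<And>j. u $ j \<le> 1"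
    and V: "real L * (\<Prod>j\<in>UNIV. u $ j) \<le> V" "exp 1 \<le> V"
  shows "\<bar>(\<Prod>j\<in>UNIV. u $ j ^ r) - 1 / real m * (\<Sum>\<mu>=1..m. \<Prod>j\<in>UNIV.
       u $ j ^ r + (\<Sum>n<N. hat_term r (u $ j) (korobov_point m a \<mu> $ j - t $ j) n))\<bar>
     \<le> 8 * exp 1 * 2 ^ CARD('n) * (1 / real L) ^ r * (4 * ln V) ^ (CARD('n) - 1)"
proof -
  define B where "B = {k :: int ^ 'n. \<forall>j. k $ j \<in> {- int N..int N}}"
  define M where "M = {k :: int ^ 'n. int m dvd char_index a k}"
  define c where "c = (\<lambda>k :: int ^ 'n. \<Prod>j\<in>UNIV. hat_coeff r (u $ j) (k $ j))"
  let ?p = "\<lambda>\<mu>. korobov_point m a \<mu>"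
  have finB: "finite B" unfolding B_def by (rule prod_sum_vec(1)) simp
  have "0 \<in> B" by (simp add: B_def)
  have "0 \<in> M" by (simp add: M_def char_index_def)
  have c0: "c 0 = (\<Prod>j\<in>UNIV. u $ j ^ r)" by (simp add: c_def hat_coeff_def)
  have expand: "of_real (\<Prod>j\<in>UNIV. u $ j ^ r + (\<Sum>n<N. hat_term r (u $ j) (y $ j - t $ j) n))
      = (\<Sum>k\<in>B. of_real (c k) * circle_exp (int_vec k \<bullet> (y - t)))" for y
    unfolding of_real_prod hat_partial_sum_complex B_def c_def circle_exp_inner
    by (subst prod_sum_vec(2)) (simp_all add: prod.distrib)
  have split: "circle_exp (int_vec k \<bullet> (y - t)) = circle_exp (- (int_vec k \<bullet> t)) * circle_exp (int_vec k \<bullet> y)" for k y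
    by (simp add: inner_diff_right right_diff_distrib exp_diff exp_minus divide_inverse mult_ac)
  have "complex_of_real (1 / real m * (\<Sum>\<mu>=1..m. \<Prod>j\<in>UNIV.
       u $ j ^ r + (\<Sum>n<N. hat_term r (u $ j) (?p \<mu> $ j - t $ j) n)))
     = (\<Sum>\<mu>=1..m. \<Sum>k\<in>B. of_real (c k) * circle_exp (int_vec k \<bullet> (?p \<mu> - t))) / of_nat m"
    by (simp only: of_real_mult of_real_sum expand of_real_divide of_real_1 of_real_of_nat_eq times_divide_eq_left mult_1_left)
  also have "\<dots> = (\<Sum>k\<in>B. \<Sum>\<mu>=1..m. of_real (c k) * circle_exp (int_vec k \<bullet> (?p \<mu> - t))) / of_nat m"
    by (subst sum.swap) (rule refl)
  also have "\<dots> = (\<Sum>k\<in>B. of_real (c k) * circle_exp (- (int_vec k \<bullet> t)) *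
      ((\<Sum>\<mu>=1..m. circle_exp (int_vec k \<bullet> ?p \<mu>)) / of_nat m))"
    unfolding split by (simp only: sum_divide_distrib sum_distrib_left mult.assoc times_divide_eq_right)
  also have "\<dots> = (\<Sum>k\<in>B. if k \<in> M then of_real (c k) * circle_exp (- (int_vec k \<bullet> t)) else 0)"
    unfolding korobov_character_average[OF m] by (intro sum.cong) (auto simp: M_def)
  also have "\<dots> = (\<Sum>k\<in>B \<inter> M. of_real (c k) * circle_exp (- (int_vec k \<bullet> t)))"
    by (simp only: sum.inter_restrict[OF finB])
  also have "\<dots> = of_real (c 0) + (\<Sum>k\<in>B \<inter> M - {0}. of_real (c k) * circle_exp (- (int_vec k \<bullet> t)))"
    using finB \<open>0 \<in> B\<close> \<open>0 \<in> M\<close> by (subst sum.remove[of _ 0]) (auto simp: int_vec_def inner_vec_def)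
  finally have "complex_of_real ((\<Prod>j\<in>UNIV. u $ j ^ r) - 1 / real m * (\<Sum>\<mu>=1..m. \<Prod>j\<in>UNIV.
       u $ j ^ r + (\<Sum>n<N. hat_term r (u $ j) (?p \<mu> $ j - t $ j) n)))
     = - (\<Sum>k\<in>B \<inter> M - {0}. of_real (c k) * circle_exp (- (int_vec k \<bullet> t)))"
    unfolding of_real_diff c0[symmetric] by simp
  from arg_cong[OF this, of cmod]
  have "\<bar>(\<Prod>j\<in>UNIV. u $ j ^ r) - 1 / real m * (\<Sum>\<mu>=1..m. \<Prod>j\<in>UNIV.
       u $ j ^ r + (\<Sum>n<N. hat_term r (u $ j) (?p \<mu> $ j - t $ j) n))\<bar>
     = cmod (\<Sum>k\<in>B \<inter> M - {0}. of_real (c k) * circle_exp (- (int_vec k \<bullet> t)))"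
    by (simp only: norm_minus_cancel norm_of_real)
  also have "\<dots> \<le> (\<Sum>k\<in>B \<inter> M - {0}. \<bar>c k\<bar>)"
    by (rule order_trans[OF norm_sum]) (simp add: norm_mult)
  also have "\<dots> \<le> (\<Sum>k\<in>B \<inter> M - {0}. (\<Prod>j\<in>UNIV. min (u $ j) (1 / 2 ^ bits (k $ j))) ^ r)"
    unfolding c_def abs_prod prod_power_distrib
    by (intro sum_mono prod_mono conjI abs_hat_coeff_le u) auto
  also have "\<dots> \<le> 8 * exp 1 * 2 ^ CARD('n) * (1 / real L) ^ r * (4 * ln V) ^ (CARD('n) - 1)"
  proof (rule lattice_sum_le[where M = M])
    \<comment> \<open>The dual lattice is closed under differences, so exactness applied to
      \<open>k - k'\<close> yields the separation property.\<close>
    fix k k' assume k: "k \<in> M" "k' \<in> M" "k - k' \<in> hyperbolic_cross L"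
    have "char_index a (k - k') = char_index a k - char_index a k'"
      by (simp add: char_index_def right_diff_distrib sum_subtractf)
    with k have "int m dvd char_index a (k - k')" by (simp add: M_def)
    from korobov_exact_lattice[OF ex m k(3) this] show "k = k'" by simp
  qed (use finB \<open>0 \<in> M\<close> u L V r in auto)
  finally show ?thesis .
qed

theorem theorem1p5:
  shows "\<exists>c > 0. \<exists>C > 0.
    \<forall>(r::nat) \<ge> 2. \<forall>(m::nat) \<ge> 1. \<forall>a :: int ^ ('n::finite). \<forall>(L::nat) \<ge> 2.
      korobov_exact m a L \<longrightarrow>
      (\<forall>v::real. 0 < v \<and> v \<le> 1 \<and> c / real L \<le> v \<longrightarrow>
        periodic_discrepancy r m (korobov_point m a) v
          \<le> ereal (C * real L powr (- real r) * ln (real L * v) ^ (CARD('n) - 1)))"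
proof (intro exI conjI allI impI)
  \<comment> \<open>The choice c = e gives \<open>real L * v \<ge> exp 1\<close>, as the partial sum
    estimate demands of its \<open>V\<close>. The factor \<open>4 ^ (CARD('n) - 1)\<close> in
    \<open>?C\<close> is pulled out of the power of \<open>4 * ln V\<close>.\<close>
  let ?C = "8 * exp 1 * 2 ^ CARD('n) * 4 ^ (CARD('n) - 1) :: real"
  show "exp 1 > (0::real)" "?C > 0" by simp_all
  fix r m L :: nat and a :: "int ^ 'n" and v :: real
  assume r: "2 \<le> r" and m: "1 \<le> m" and L: "2 \<le> L" and ex: "korobov_exact m a L"
    and v: "0 < v \<and> v \<le> 1 \<and> exp 1 / real L \<le> v"
  define bound where "bound = ?C * real L powr (- real r) * ln (real L * v) ^ (CARD('n) - 1)"
  have bound: "8 * exp 1 * 2 ^ CARD('n) * (1 / real L) ^ r * (4 * ln (real L * v)) ^ (CARD('n) - 1) = bound"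
    using L by (simp add: bound_def powr_minus powr_realpow power_mult_distrib power_inverse divide_inverse mult_ac)
  have V: "exp 1 \<le> real L * v" using v L by (simp add: divide_le_eq mult.commute)
  show "periodic_discrepancy r m (korobov_point m a) v \<le> ereal bound"
    unfolding periodic_discrepancy_def
  proof (rule SUP_least, clarify)
    fix w u :: "real ^ 'n"
    assume adm: "(w, u) \<in> admissible_boxes r v"
    have "1 \<le> r" using r by simp
    note u = admissible_box_bounds[OF adm this]
    have u1: "u $ j \<le> 1" for j
    proof -
      have "1 * u $ j \<le> real r * u $ j" using u(1)[of j] r by (intro mult_right_mono) auto
      with u(2)[of j] show ?thesis by simp
    qed
    have LU: "real L * (\<Prod>j\<in>UNIV. u $ j) \<le> real L * v"
      using u(3) by (intro mult_left_mono) auto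
    let ?H = "\<lambda>j. hat_series r (u $ j)"
    have cont: "continuous_on UNIV (?H j)" for j by (rule continuous_on_hat_series[OF r])
    have eq: "periodic_box_hat r w u (x - z) = (\<Prod>j\<in>UNIV. ?H j (x $ j - (z + w) $ j))" for x z
      using periodic_box_hat_eq[OF r u(1,2), of w "x - z"] by (simp add: diff_diff_eq)
    have int: "(LINT x:unit_cube|lborel. periodic_box_hat r w u (x - z)) = (\<Prod>j\<in>UNIV. u $ j ^ r)" for z
    proof -
      have "(LINT x:unit_cube|lborel. periodic_box_hat r w u (x - z))
         = (\<Prod>j\<in>UNIV. LINT y|lborel. indicator {0..1} y *\<^sub>R ?H j (y - (z + w) $ j))"
        unfolding eq
        by (rule integral_unit_cube_prod[of "\<lambda>j y. ?H j (y - (z + w) $ j)"])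
           (rule continuous_on_compose2[OF cont], auto intro!: continuous_intros)
      then show ?thesis by (simp only: hat_series_integral_period[OF r])
    qed
    let ?E = "\<lambda>z. \<bar>(\<Prod>j\<in>UNIV. u $ j ^ r) -
        1 / real m * (\<Sum>\<mu>=1..m. \<Prod>j\<in>UNIV. ?H j (korobov_point m a \<mu> $ j - (z + w) $ j))\<bar>"
    \<comment> \<open>The bound on the partial sums is uniform in \<open>N\<close>, so it passes to
      the limit.\<close>
    have E: "?E z \<le> bound" for z
    proof (rule tendsto_upperbound)
      show "(\<lambda>N. \<bar>(\<Prod>j\<in>UNIV. u $ j ^ r) - 1 / real m * (\<Sum>\<mu>=1..m. \<Prod>j\<in>UNIV.
        u $ j ^ r + (\<Sum>n<N. hat_term r (u $ j) (korobov_point m a \<mu> $ j - (z + w) $ j) n))\<bar>)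
        \<longlonglongrightarrow> ?E z"
        by (intro tendsto_rabs tendsto_diff tendsto_const tendsto_mult tendsto_sum tendsto_prod hat_series_LIMSEQ r)
      show "\<forall>\<^sub>F N in sequentially. \<bar>(\<Prod>j\<in>UNIV. u $ j ^ r) - 1 / real m * (\<Sum>\<mu>=1..m. \<Prod>j\<in>UNIV.
        u $ j ^ r + (\<Sum>n<N. hat_term r (u $ j) (korobov_point m a \<mu> $ j - (z + w) $ j) n))\<bar> \<le> bound"
        unfolding bound[symmetric] using L
        by (intro always_eventually allI korobov_partial_sum_error_le[OF ex m _ r u(1) u1 LU V]) simp
    qed simp
    show "esssup (restrict_space lborel unit_cube)
         (\<lambda>z. ereal \<bar>(LINT x:unit_cube|lborel. periodic_box_hat r w u (x - z))
                   - 1 / real m * (\<Sum>\<mu>=1..m. periodic_box_hat r w u (korobov_point m a \<mu> - z))\<bar>)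
        \<le> ereal bound"
      \<comment> \<open>The integral is replaced first, since \<open>eq\<close> would also rewrite
        its integrand. Measurability in \<open>z\<close> then follows from continuity of the
        series.\<close>
      unfolding int unfolding eq
    proof (rule esssup_I)
      have "continuous_on UNIV ?E"
        by (intro continuous_on_rabs continuous_on_diff continuous_on_mult continuous_on_sum
            continuous_on_prod continuous_on_const continuous_on_compose2[OF cont]) (auto intro!: continuous_intros)
      then have "(\<lambda>z. ereal (?E z)) \<in> borel_measurable lborel"
        by (intro borel_measurable_ereal) (simp add: borel_measurable_continuous_onI)
      then show "(\<lambda>z. ereal (?E z)) \<in> borel_measurable (restrict_space lborel unit_cube)"
        by (rule measurable_restrict_space1)
      show "AE z in restrict_space lborel unit_cube. ereal (?E z) \<le> ereal bound"
        by (intro AE_I2) (simp only: ereal_less_eq E)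
    qed
  qed
qed

end
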